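(* There is a polynomial time $O(\log D)$-approximation algorithm for the problem $Q|f_i|C_{\min}$, where $D=D_{\max}/D_{\min}$ is the ratio between the largest and smallest machine demand of the instance.
   Context: $Q|f_i|C_{\min}$: given $m$ machines, machine $i$ having a demand $D_i>0$ and a cardinality constraint $f_i\in\mathbb{Z}_{\ge 1}$, and $n$ jobs with capacities $c_1,\dots,c_n>0$, a feasible assignment assigns each job to at most one machine such that machine $i$ receives at most $f_i$ jobs and total capacity at least $D_i$. An $\alpha$-approximation algorithm, on any instance admitting a feasible assignment, outputs an assignment respecting the cardinality constraints in which every machine $i$ receives total capacity at least $D_i/\alpha$. *)

theory Defs
  imports
    Complex_Main
    "HOL-Computational_Algebra.Polynomial"
    "HOL-Library.Discrete_Functions"
begin

section \<open>Model of computation\<close>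

text \<open>
  Algorithms are programs of a deterministic while-language whose values are binary trees with
  natural numbers at the leaves. Cost is logarithmic: evaluating an expression costs, for every
  node of the expression, the size of the value computed at that node, where a number is charged
  the length of its binary representation. Values are charged for in full each time they are
  read, copied or produced (no sharing of subtrees is assumed), and the arithmetic primitives are
  computable in time polynomial in the lengths of their operands. Hence a program running in
  polynomial time in this sense can be simulated by a Turing machine in polynomial time and vice
  versa.
\<close>

datatype val = Num nat | Node val val

type_synonym state = "nat \<Rightarrow> val"

datatype exp =
    Var nat
  | Const nat
  | Pair_exp exp exp
  | Left exp
  | Right exp
  | Add exp exp
  | Sub exp exp
  | Mul exp exp
  | Div exp exp
  | Less exp exp

datatype com =
    Skip
  | Assign nat exp
  | Seq com com
  | If exp com com
  | While exp com

text \<open>The length of the binary numeral is \<open>floor_log n + 1\<close> (and 1 for \<open>n = 0\<close>).\<close>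

fun val_size :: "val \<Rightarrow> nat" where
  "val_size (Num n) = Suc (floor_log n)"
| "val_size (Node a b) = Suc (val_size a + val_size b)"

text \<open>All primitives are total; ill-typed operands are read as \<open>0\<close>.\<close>

fun num_of :: "val \<Rightarrow> nat" where
  "num_of (Num n) = n"
| "num_of (Node a b) = 0"

fun left_of :: "val \<Rightarrow> val" where
  "left_of (Num n) = Num 0"
| "left_of (Node a b) = a"

fun right_of :: "val \<Rightarrow> val" where
  "right_of (Num n) = Num 0"
| "right_of (Node a b) = b"

fun eval_exp :: "state \<Rightarrow> exp \<Rightarrow> val" where
  "eval_exp s (Var x) = s x"
| "eval_exp s (Const n) = Num n"
| "eval_exp s (Pair_exp a b) = Node (eval_exp s a) (eval_exp s b)"
| "eval_exp s (Left a) = left_of (eval_exp s a)"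
| "eval_exp s (Right a) = right_of (eval_exp s a)"
| "eval_exp s (Add a b) = Num (num_of (eval_exp s a) + num_of (eval_exp s b))"
| "eval_exp s (Sub a b) = Num (num_of (eval_exp s a) - num_of (eval_exp s b))"
| "eval_exp s (Mul a b) = Num (num_of (eval_exp s a) * num_of (eval_exp s b))"
| "eval_exp s (Div a b) = Num (num_of (eval_exp s a) div num_of (eval_exp s b))"
| "eval_exp s (Less a b) = Num (if num_of (eval_exp s a) < num_of (eval_exp s b) then 1 else 0)"

fun cost_exp :: "state \<Rightarrow> exp \<Rightarrow> nat" where
  "cost_exp s (Var x) = val_size (s x)"
| "cost_exp s (Const n) = val_size (Num n)"
| "cost_exp s (Pair_exp a b) = val_size (eval_exp s (Pair_exp a b)) + cost_exp s a + cost_exp s b"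
| "cost_exp s (Left a) = val_size (eval_exp s (Left a)) + cost_exp s a"
| "cost_exp s (Right a) = val_size (eval_exp s (Right a)) + cost_exp s a"
| "cost_exp s (Add a b) = val_size (eval_exp s (Add a b)) + cost_exp s a + cost_exp s b"
| "cost_exp s (Sub a b) = val_size (eval_exp s (Sub a b)) + cost_exp s a + cost_exp s b"
| "cost_exp s (Mul a b) = val_size (eval_exp s (Mul a b)) + cost_exp s a + cost_exp s b"
| "cost_exp s (Div a b) = val_size (eval_exp s (Div a b)) + cost_exp s a + cost_exp s b"
| "cost_exp s (Less a b) = val_size (eval_exp s (Less a b)) + cost_exp s a + cost_exp s b"

text \<open>
  \<open>exec c s t s'\<close>: started in \<open>s\<close>, the program \<open>c\<close> terminates in \<open>s'\<close> at total cost \<open>t\<close>.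
  The number \<open>0\<close> is the only false value (so, with \<open>Num 0\<close> as the empty list, a list is true
  iff it is nonempty).
\<close>

inductive exec :: "com \<Rightarrow> state \<Rightarrow> nat \<Rightarrow> state \<Rightarrow> bool" where
  Skip: "exec Skip s 1 s"
| Assign: "exec (Assign x e) s (cost_exp s e) (s(x := eval_exp s e))"
| Seq: "exec c1 s t1 s1 \<Longrightarrow> exec c2 s1 t2 s2 \<Longrightarrow> exec (Seq c1 c2) s (t1 + t2) s2"
| IfTrue: "eval_exp s e \<noteq> Num 0 \<Longrightarrow> exec c1 s t s' \<Longrightarrow>
    exec (If e c1 c2) s (cost_exp s e + t) s'"
| IfFalse: "eval_exp s e = Num 0 \<Longrightarrow> exec c2 s t s' \<Longrightarrow>
    exec (If e c1 c2) s (cost_exp s e + t) s'"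
| WhileFalse: "eval_exp s e = Num 0 \<Longrightarrow> exec (While e c) s (cost_exp s e) s"
| WhileTrue: "eval_exp s e \<noteq> Num 0 \<Longrightarrow> exec c s t1 s1 \<Longrightarrow> exec (While e c) s1 t2 s2 \<Longrightarrow>
    exec (While e c) s (cost_exp s e + t1 + t2) s2"

inductive_cases exec_SkipE: "exec Skip s t s'"
inductive_cases exec_AssignE: "exec (Assign x e) s t s'"
inductive_cases exec_SeqE: "exec (Seq c1 c2) s t s'"
inductive_cases exec_IfE: "exec (If e c1 c2) s t s'"
inductive_cases exec_WhileE: "exec (While e c) s t s'"

lemma exec_deterministic:
  "exec c s t s' \<Longrightarrow> exec c s u s'' \<Longrightarrow> u = t \<and> s'' = s'"
proof (induction arbitrary: u s'' rule: exec.induct)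
  case (Skip s)
  then show ?case by (rule exec_SkipE) simp
next
  case (Assign x e s)
  then show ?case by (rule exec_AssignE) simp
next
  case (Seq c1 s t1 s1 c2 t2 s2)
  from Seq.prems show ?case by (rule exec_SeqE) (metis Seq.IH)
next
  case (IfTrue s e c1 t s' c2)
  from IfTrue.prems show ?case
    by (rule exec_IfE) (metis IfTrue.IH, metis IfTrue.hyps(1))
next
  case (IfFalse s e c2 t s' c1)
  from IfFalse.prems show ?case
    by (rule exec_IfE) (metis IfFalse.hyps(1), metis IfFalse.IH)
next
  case (WhileFalse s e c)
  from WhileFalse.prems show ?case
    by (rule exec_WhileE) (simp, metis WhileFalse.hyps(1))
next
  case (WhileTrue s e c t1 s1 t2 s2)
  from WhileTrue.prems show ?case
    by (rule exec_WhileE) (metis WhileTrue.hyps(1), metis WhileTrue.IH)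
qed

text \<open>Input and output are passed in variable 0.\<close>

definition run :: "com \<Rightarrow> val \<Rightarrow> nat \<Rightarrow> val \<Rightarrow> bool" where
  "run p x t y \<longleftrightarrow> (\<exists>s'. exec p ((\<lambda>_. Num 0)(0 := x)) t s' \<and> s' 0 = y)"

definition outputs :: "com \<Rightarrow> val \<Rightarrow> val \<Rightarrow> bool" where
  "outputs p x y \<longleftrightarrow> (\<exists>t. run p x t y)"

definition polynomial_time_on :: "val set \<Rightarrow> com \<Rightarrow> bool" where
  "polynomial_time_on X p \<longleftrightarrow>
     (\<exists>q :: nat poly. \<forall>x\<in>X. \<exists>t y. run p x t y \<and> t \<le> poly q (val_size x))"


section \<open>The problem\<close>

text \<open>
  Machine \<open>i\<close> is the pair of its demand and its cardinality constraint; jobs are given by their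
  capacities. Machines and jobs are numbered from 0.
\<close>

record qfc_instance =
  machines :: "(rat \<times> nat) list"
  jobs :: "rat list"

abbreviation num_machines :: "qfc_instance \<Rightarrow> nat" where
  "num_machines I \<equiv> length (machines I)"

abbreviation num_jobs :: "qfc_instance \<Rightarrow> nat" where
  "num_jobs I \<equiv> length (jobs I)"

definition demand :: "qfc_instance \<Rightarrow> nat \<Rightarrow> rat" where
  "demand I i = fst (machines I ! i)"

definition cardinality_bound :: "qfc_instance \<Rightarrow> nat \<Rightarrow> nat" where
  "cardinality_bound I i = snd (machines I ! i)"

definition capacity :: "qfc_instance \<Rightarrow> nat \<Rightarrow> rat" where
  "capacity I j = jobs I ! j"

text \<open>At least one machine is required, so that the demand ratio is defined.\<close>

definition valid_instance :: "qfc_instance \<Rightarrow> bool" where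
  "valid_instance I \<longleftrightarrow>
     num_machines I \<ge> 1 \<and>
     (\<forall>i < num_machines I. demand I i > 0 \<and> cardinality_bound I i \<ge> 1) \<and>
     (\<forall>j < num_jobs I. capacity I j > 0)"

definition demand_ratio :: "qfc_instance \<Rightarrow> rat" where
  "demand_ratio I =
     Max (demand I ` {..<num_machines I}) / Min (demand I ` {..<num_machines I})"

text \<open>Entry \<open>j\<close> of an assignment is the machine job \<open>j\<close> is assigned to, if any.\<close>

type_synonym assignment = "nat option list"

definition is_assignment :: "qfc_instance \<Rightarrow> assignment \<Rightarrow> bool" where
  "is_assignment I \<sigma> \<longleftrightarrow>
     length \<sigma> = num_jobs I \<and> (\<forall>i. Some i \<in> set \<sigma> \<longrightarrow> i < num_machines I)"

definition jobs_on :: "qfc_instance \<Rightarrow> assignment \<Rightarrow> nat \<Rightarrow> nat set" where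
  "jobs_on I \<sigma> i = {j. j < num_jobs I \<and> \<sigma> ! j = Some i}"

definition respects_cardinalities :: "qfc_instance \<Rightarrow> assignment \<Rightarrow> bool" where
  "respects_cardinalities I \<sigma> \<longleftrightarrow>
     (\<forall>i < num_machines I. card (jobs_on I \<sigma> i) \<le> cardinality_bound I i)"

definition received :: "qfc_instance \<Rightarrow> assignment \<Rightarrow> nat \<Rightarrow> rat" where
  "received I \<sigma> i = (\<Sum>j\<in>jobs_on I \<sigma> i. capacity I j)"

definition feasible :: "qfc_instance \<Rightarrow> assignment \<Rightarrow> bool" where
  "feasible I \<sigma> \<longleftrightarrow>
     is_assignment I \<sigma> \<and> respects_cardinalities I \<sigma> \<and>
     (\<forall>i < num_machines I. received I \<sigma> i \<ge> demand I i)"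

definition approximately_feasible :: "real \<Rightarrow> qfc_instance \<Rightarrow> assignment \<Rightarrow> bool" where
  "approximately_feasible \<alpha> I \<sigma> \<longleftrightarrow>
     is_assignment I \<sigma> \<and> respects_cardinalities I \<sigma> \<and>
     (\<forall>i < num_machines I. real_of_rat (received I \<sigma> i) \<ge> real_of_rat (demand I i) / \<alpha>)"


section \<open>Encodings and approximation algorithms\<close>

text \<open>
  Numbers are encoded in binary (by the leaves), rationals by numerator and denominator in lowest
  terms. Only nonnegative rationals occur.
\<close>

definition encode_rat :: "rat \<Rightarrow> val" where
  "encode_rat r = (case quotient_of r of (a, b) \<Rightarrow> Node (Num (nat a)) (Num (nat b)))"

fun encode_list :: "('a \<Rightarrow> val) \<Rightarrow> 'a list \<Rightarrow> val" where
  "encode_list enc [] = Num 0"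
| "encode_list enc (x # xs) = Node (enc x) (encode_list enc xs)"

definition encode_instance :: "qfc_instance \<Rightarrow> val" where
  "encode_instance I =
     Node (encode_list (\<lambda>(d, f). Node (encode_rat d) (Num f)) (machines I))
          (encode_list encode_rat (jobs I))"

definition encode_assignment :: "assignment \<Rightarrow> val" where
  "encode_assignment = encode_list (\<lambda>x. case x of None \<Rightarrow> Num 0 | Some i \<Rightarrow> Num (Suc i))"

text \<open>The approximation guarantee may depend on the instance.\<close>

definition approximation_algorithm :: "(qfc_instance \<Rightarrow> real) \<Rightarrow> com \<Rightarrow> bool" where
  "approximation_algorithm \<alpha> p \<longleftrightarrow>
     (\<forall>I. valid_instance I \<and> (\<exists>\<sigma>. feasible I \<sigma>) \<longrightarrow>
        (\<exists>\<sigma>. outputs p (encode_instance I) (encode_assignment \<sigma>) \<and>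
             approximately_feasible (\<alpha> I) I \<sigma>))"

definition polynomial_time :: "com \<Rightarrow> bool" where
  "polynomial_time p \<longleftrightarrow> polynomial_time_on (encode_instance ` {I. valid_instance I}) p"

end

theory Submission
  imports Defs "HOL-Library.Multiset"
begin

text \<open>
  After scaling to natural numbers, split the machines into \<open>L\<close> classes: the first class starts at
  the smallest demand, and a new class starts at the first demand exceeding twice the start of the
  current one, so \<open>L \<le> 1 + log 2 D\<close>. Put \<open>\<beta> = 8 * L\<close>; a machine of the class starting at \<open>d\<close> will
  receive at least \<open>d / \<beta>\<close>. Call a job big for the class if it alone has this capacity, and small
  otherwise; a job that is small for a class is small for all later ones.

  The classes are processed in order of increasing \<open>d\<close>, and the \<open>k\<close>-th class uses only every \<open>L\<close>-th
  job, starting with the \<open>k\<close>-th, of the sorted list of its small jobs. Later classes only append to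
  that list, so no small job is used twice, while the loss is a factor \<open>L\<close> and at most one job per
  residue class. A machine with \<open>f\<close> slots in a solution obtains half of its demand from jobs of
  capacity at least \<open>d / (2 * f)\<close>, and conversely \<open>f\<close> such jobs are more than enough for \<open>d / \<beta>\<close>.
  Hence the cardinality constraints turn into nested eligibility constraints, for which a greedy
  that treats the machines by decreasing \<open>f\<close> serves as many machines by small jobs alone as any
  solution does. The remaining machines receive the smallest big jobs, one each. These are no more
  than the machines to which the solution gives a big job, so by exchange the jobs left over still
  satisfy the later classes.
\<close>

section \<open>Polynomial bounds\<close>

text \<open>The difficulty is that the classes compete for the small jobs. Fixing the residue
  classes beforehand removes this competition: in the analysis every class may use all small jobs of
  the solution, and only big jobs have to be accounted for from one class to the next.

  The constant 8 in \<beta> leaves room for three losses: a factor 2 for ignoring jobs below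
  \<open>d / (2 * f)\<close>, a factor 2 because a greedily filled machine may overshoot its target
  up to twofold, and an additive loss of up to one small job per residue class. For \<open>q\<close>
  machines this reads \<open>4 * q - 1 >= 2 * q\<close>. The ratio of a demand to the start of its
  class adds a last factor 2, hence 16.

  Polynomial time is a claim about programs of the while-language, so the algorithm is composed of
  pairs, arithmetic, filters and left folds, for which closure rules are proved once. As a fold may
  blow up its accumulator exponentially, each fold needs a polynomial bound on the size of its
  accumulators; all other costs follow by composition.\<close>

definition poly_bounded :: "('x \<Rightarrow> nat) \<Rightarrow> ('x \<Rightarrow> nat) \<Rightarrow> bool" where
  "poly_bounded n g \<longleftrightarrow> (\<exists>k. \<forall>x. g x \<le> (n x + 2) ^ k)"

lemma poly_boundedI: "(\<And>x. g x \<le> (n x + 2) ^ k) \<Longrightarrow> poly_bounded n g"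
  unfolding poly_bounded_def by blast

lemma poly_bounded_mono:
  assumes "poly_bounded n h" "\<And>x. g x \<le> h x"
  shows "poly_bounded n g"
  using assms unfolding poly_bounded_def by (meson le_trans)

lemma poly_bounded_self: "poly_bounded n n"
  by (rule poly_boundedI[where k = 1]) simp

text \<open>The base \<open>n x + 2\<close> is at least 2 even for size 0. A constant is therefore
  absorbed by the exponent, and the factor 2 of a sum by one more power, so that a single exponent
  describes every bound.\<close>

lemma poly_bounded_const: "poly_bounded n (\<lambda>x. c)"
proof (rule poly_boundedI[where k = c])
  fix x
  have "c \<le> 2 ^ c" by (simp add: less_imp_le)
  also have "\<dots> \<le> (n x + 2) ^ c" by (rule power_mono) auto
  finally show "c \<le> (n x + 2) ^ c" .
qed

lemma poly_bounded_mult: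
  assumes "poly_bounded n g" "poly_bounded n h"
  shows "poly_bounded n (\<lambda>x. g x * h x)"
proof -
  obtain i j where "\<And>x. g x \<le> (n x + 2) ^ i" "\<And>x. h x \<le> (n x + 2) ^ j"
    using assms unfolding poly_bounded_def by blast
  then show ?thesis
    by (intro poly_boundedI[where k = "i + j"]) (simp add: power_add mult_mono)
qed

lemma poly_bounded_add:
  assumes "poly_bounded n g" "poly_bounded n h"
  shows "poly_bounded n (\<lambda>x. g x + h x)"
proof -
  obtain i j where i: "\<And>x. g x \<le> (n x + 2) ^ i" and j: "\<And>x. h x \<le> (n x + 2) ^ j"
    using assms unfolding poly_bounded_def by blast
  have "g x + h x \<le> (n x + 2) ^ (i + j + 1)" for x
  proof -
    have "g x \<le> (n x + 2) ^ (i + j)" "h x \<le> (n x + 2) ^ (i + j)"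
      using i[of x] j[of x] by (meson le_add1 le_add2 le_trans power_increasing one_le_numeral)+
    then have "g x + h x \<le> 2 * (n x + 2) ^ (i + j)" by simp
    also have "\<dots> \<le> (n x + 2) * (n x + 2) ^ (i + j)" by (rule mult_right_mono) auto
    finally show ?thesis by simp
  qed
  then show ?thesis by (rule poly_boundedI)
qed

lemma poly_bounded_power:
  assumes "poly_bounded n g"
  shows "poly_bounded n (\<lambda>x. g x ^ k)"
  by (induction k) (auto intro: poly_bounded_const poly_bounded_mult assms)

lemma poly_bounded_trans:
  assumes "poly_bounded n g" "poly_bounded g h"
  shows "poly_bounded n h"
proof -
  obtain k where "\<And>x. h x \<le> (g x + 2) ^ k"
    using assms(2) unfolding poly_bounded_def by blast
  then show ?thesis
    by (intro poly_bounded_mono[where g = h, OF poly_bounded_power[OF poly_bounded_add, of n g "\<lambda>_. 2" k]])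
      (auto intro: assms poly_bounded_const)
qed

lemma poly_bounded_compose: "poly_bounded n g \<Longrightarrow> poly_bounded (\<lambda>x. n (f x)) (\<lambda>x. g (f x))"
  unfolding poly_bounded_def by blast

lemmas poly_bounded_intros =
  poly_bounded_const poly_bounded_add poly_bounded_mult poly_bounded_power


section \<open>Polynomial-time functions\<close>

text \<open>With one encoding per type, the closure rules below compose by type alone. The instances
  agree with \<open>encode_instance\<close> on its components. \<open>False\<close> and
  \<open>[]\<close> both become \<open>Num 0\<close>, the only false value, so booleans and lists
  can be tested directly by \<open>If\<close> and \<open>While\<close>.\<close>

class enc =
  fixes enc :: "'a \<Rightarrow> val"

instantiation nat :: enc begin
definition enc_nat :: "nat \<Rightarrow> val" where "enc_nat n = Num n"
instance ..
end

instantiation bool :: enc begin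
definition enc_bool :: "bool \<Rightarrow> val" where "enc_bool b = Num (if b then 1 else 0)"
instance ..
end

instantiation rat :: enc begin
definition enc_rat :: "rat \<Rightarrow> val" where "enc_rat = encode_rat"
instance ..
end

instantiation prod :: (enc, enc) enc begin
definition enc_prod :: "'a \<times> 'b \<Rightarrow> val" where "enc_prod p = Node (enc (fst p)) (enc (snd p))"
instance ..
end

instantiation list :: (enc) enc begin
definition enc_list :: "'a list \<Rightarrow> val" where "enc_list = encode_list enc"
instance ..
end

section \<open>Sizes of encoded values\<close>

abbreviation size_of :: "'a::enc \<Rightarrow> nat" where
  "size_of x \<equiv> val_size (enc x)"

lemma enc_list_simps [simp]: "enc [] = Num 0" "enc (x # xs) = Node (enc x) (enc xs)"
  by (simp_all add: enc_list_def)

lemma size_of_pos: "0 < size_of x"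
  by (cases "enc x") auto

lemma size_of_simps [simp]:
  "size_of (n :: nat) = Suc (floor_log n)"
  "size_of (x, y) = Suc (size_of x + size_of y)"
  "size_of ([] :: 'a list) = 1"
  "size_of (z # zs) = Suc (size_of z + size_of zs)"
  for x :: "'a::enc" and y :: "'b::enc" and z :: "'a::enc"
  by (simp_all add: enc_nat_def enc_prod_def)

lemma size_of_bool: "size_of (b :: bool) = 1"
  by (simp add: enc_bool_def)

lemma length_le_size_of: "length xs \<le> size_of xs"
  by (induction xs) auto

lemma size_of_mem: "x \<in> set xs \<Longrightarrow> size_of x \<le> size_of xs"
  by (induction xs) auto

text \<open>In terms of \<open>size_of\<close>: a sum is no larger than its operands together. This
  is crude for a sum, but it has the shape that folds need, since the growth of an accumulated
  number is bounded by the size of the new operand alone.\<close>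

lemma floor_log_add_le: "floor_log (a + b) \<le> Suc (floor_log a + floor_log b)"
proof (cases "a = 0 \<or> b = 0")
  case False
  have "a < 2 ^ Suc (floor_log a)" "b < 2 ^ Suc (floor_log b)"
    by (simp_all add: floor_log_exp2_gt)
  moreover have "(2::nat) ^ Suc (floor_log a) \<le> 2 ^ Suc (floor_log a + floor_log b)"
    "(2::nat) ^ Suc (floor_log b) \<le> 2 ^ Suc (floor_log a + floor_log b)"
    by (auto intro: power_increasing)
  ultimately have "a + b < 2 ^ Suc (floor_log a + floor_log b) + 2 ^ Suc (floor_log a + floor_log b)"
    by linarith
  then have "a + b < 2 ^ Suc (Suc (floor_log a + floor_log b))"
    by simp
  then have "floor_log (a + b) < Suc (Suc (floor_log a + floor_log b))"
    using False by (metis add_is_0 floor_log_exp2_le gr0I le_less_trans nat_power_less_imp_less pos2)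
  then show ?thesis by simp
qed auto

lemma floor_log_mult_le: "floor_log (a * b) \<le> Suc (floor_log a + floor_log b)"
proof (cases "a = 0 \<or> b = 0")
  case False
  have "a < 2 ^ Suc (floor_log a)" "b < 2 ^ Suc (floor_log b)"
    by (simp_all add: floor_log_exp2_gt)
  then have "a * b < 2 ^ Suc (floor_log a) * 2 ^ Suc (floor_log b)"
    by (rule mult_strict_mono) auto
  then have "a * b < 2 ^ Suc (Suc (floor_log a + floor_log b))"
    by (simp add: power_add)
  then have "floor_log (a * b) < Suc (Suc (floor_log a + floor_log b))"
    using False by (metis floor_log_exp2_le gr0I le_less_trans mult_is_0 nat_power_less_imp_less pos2)
  then show ?thesis by simp
qed auto

lemma floor_log_le: "a \<le> b \<Longrightarrow> floor_log a \<le> floor_log b"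
  by (rule monoD[OF floor_log_mono])

section \<open>Execution within a cost bound\<close>

definition exec_within :: "com \<Rightarrow> state \<Rightarrow> nat \<Rightarrow> state \<Rightarrow> bool" where
  "exec_within c s b s' \<longleftrightarrow> (\<exists>t\<le>b. exec c s t s')"

lemma exec_within_mono: "exec_within c s b s' \<Longrightarrow> b \<le> b' \<Longrightarrow> exec_within c s b' s'"
  unfolding exec_within_def by (meson le_trans)

lemma exec_within_Assign: "exec_within (Assign x e) s (cost_exp s e) (s(x := eval_exp s e))"
  unfolding exec_within_def by (blast intro: exec.Assign)

lemma exec_within_AssignI:
  "cost_exp s e \<le> b \<Longrightarrow> s(x := eval_exp s e) = s' \<Longrightarrow> exec_within (Assign x e) s b s'"
  using exec_within_Assign exec_within_mono by metis

lemma exec_within_Seq: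
  "exec_within c1 s b1 s1 \<Longrightarrow> exec_within c2 s1 b2 s2 \<Longrightarrow> exec_within (Seq c1 c2) s (b1 + b2) s2"
  unfolding exec_within_def by (meson add_mono exec.Seq)

lemma exec_within_IfTrue:
  "eval_exp s e \<noteq> Num 0 \<Longrightarrow> exec_within c1 s b s' \<Longrightarrow> exec_within (If e c1 c2) s (cost_exp s e + b) s'"
  unfolding exec_within_def by (meson add_le_mono exec.IfTrue le_refl)

lemma exec_within_IfFalse:
  "eval_exp s e = Num 0 \<Longrightarrow> exec_within c2 s b s' \<Longrightarrow> exec_within (If e c1 c2) s (cost_exp s e + b) s'"
  unfolding exec_within_def by (meson add_le_mono exec.IfFalse le_refl)

lemma exec_within_WhileFalse:
  "eval_exp s e = Num 0 \<Longrightarrow> exec_within (While e c) s (cost_exp s e) s"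
  unfolding exec_within_def by (blast intro: exec.WhileFalse)

lemma exec_within_WhileTrue:
  "eval_exp s e \<noteq> Num 0 \<Longrightarrow> exec_within c s b1 s1 \<Longrightarrow> exec_within (While e c) s1 b2 s2 \<Longrightarrow>
    exec_within (While e c) s (cost_exp s e + b1 + b2) s2"
  unfolding exec_within_def by (meson add_le_mono exec.WhileTrue le_refl)

lemma val_size_le_cost: "val_size (eval_exp s e) \<le> cost_exp s e"
  by (cases e) auto

text \<open>Every value that is written has been paid for in full, so no variable can grow by more
  than the cost spent.\<close>

lemma exec_val_size: "exec c s t s' \<Longrightarrow> val_size (s' x) \<le> val_size (s x) + t"
  by (induction rule: exec.induct) (auto simp: val_size_le_cost trans_le_add2)

text \<open>
  Argument and result are passed in variable 0; variable 1 holds a stack, which must be left as it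
  was found, so that programs can be nested without renaming their variables.
\<close>

definition ptime :: "('a::enc \<Rightarrow> 'b::enc) \<Rightarrow> bool" where
  "ptime f \<longleftrightarrow> (\<exists>p k. \<forall>a s. s 0 = enc a \<longrightarrow>
     (\<exists>s'. exec_within p s ((size_of a + val_size (s 1) + 2) ^ k) s' \<and> s' 0 = enc (f a) \<and> s' 1 = s 1))"

text \<open>The time is measured in argument and stack together: pushing and popping copy the whole
  stack at full cost, so a nested program also pays for what its callers have saved.\<close>

lemma ptimeI:
  assumes "\<And>a s. s 0 = enc a \<Longrightarrow>
      \<exists>s'. exec_within p s (T (a, val_size (s 1))) s' \<and> s' 0 = enc (f a) \<and> s' 1 = s 1"
    and "poly_bounded (\<lambda>(a, n). size_of a + n) T"
  shows "ptime f"
proof -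
  obtain k where k: "\<And>a n. T (a, n) \<le> (size_of a + n + 2) ^ k"
    using assms(2) unfolding poly_bounded_def by auto
  show ?thesis
    unfolding ptime_def
    by (rule exI[of _ p], rule exI[of _ k]) (meson assms(1) k exec_within_mono)
qed

text \<open>Time bounds size, by \<open>exec_val_size\<close>. This keeps composition free of size
  hypotheses: the outer program is bounded in terms of the inner result, which is polynomially small
  by itself.\<close>

lemma ptime_size:
  assumes "ptime f"
  shows "poly_bounded size_of (\<lambda>a. size_of (f a))"
proof -
  obtain p k where p: "\<And>a s. s 0 = enc a \<Longrightarrow>
     \<exists>s'. exec_within p s ((size_of a + val_size (s 1) + 2) ^ k) s' \<and> s' 0 = enc (f a) \<and> s' 1 = s 1"
    using assms unfolding ptime_def by blast
  have "size_of (f a) \<le> size_of a + (size_of a + 1 + 2) ^ k" for a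
  proof -
    let ?s = "(\<lambda>_. Num 0)(0 := enc a)"
    obtain s' t where "exec p ?s t s'" "t \<le> (size_of a + 1 + 2) ^ k" "s' 0 = enc (f a)"
      using p[of ?s a] unfolding exec_within_def by auto
    then show ?thesis using exec_val_size[of p ?s t s' 0] by simp
  qed
  then show ?thesis
    by (intro poly_bounded_mono[OF poly_bounded_add[OF poly_bounded_self poly_bounded_power[OF
        poly_bounded_add[OF poly_bounded_add[OF poly_bounded_self poly_bounded_const] poly_bounded_const]]]])
qed

lemma ptime_exp:
  fixes f :: "'a::enc \<Rightarrow> 'b::enc"
  assumes "\<And>a s. s 0 = enc a \<Longrightarrow> eval_exp s e = enc (f a)"
    and "\<And>(a::'a) s. s 0 = enc a \<Longrightarrow> cost_exp s e \<le> c * (size_of a + 1)"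
  shows "ptime f"
proof (rule ptimeI[where p = "Assign 0 e" and T = "\<lambda>(a, n). c * (size_of a + n + 1)"])
  fix a :: 'a and s :: state assume s: "s 0 = enc a"
  have "exec_within (Assign 0 e) s (c * (size_of a + val_size (s 1) + 1)) (s(0 := eval_exp s e))"
    by (rule exec_within_mono[OF exec_within_Assign])
      (use assms(2)[where s = s and a = a] s in \<open>auto elim: le_trans\<close>)
  then show "\<exists>s'. exec_within (Assign 0 e) s (case (a, val_size (s 1)) of (a, n) \<Rightarrow> c * (size_of a + n + 1)) s' \<and>
      s' 0 = enc (f a) \<and> s' 1 = s 1"
    using assms(1)[where s = s and a = a] s by auto
next
  show "poly_bounded (\<lambda>(a::'a, n). size_of a + n) (\<lambda>(a, n). c * (size_of a + n + 1))"
    using poly_bounded_mult[OF poly_bounded_const[of _ c]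
        poly_bounded_add[OF poly_bounded_self poly_bounded_const[of _ 1]],
        of "\<lambda>(a::'a, n). size_of a + n"]
    by (simp add: case_prod_unfold)
qed

section \<open>Closure under composition, pairing, branching and arithmetic\<close>

lemma ptime_id: "ptime (\<lambda>x. x)"
  by (rule ptime_exp[where e = "Var 0" and c = 1]) auto

lemma ptime_comp:
  fixes f :: "'a::enc \<Rightarrow> 'b::enc" and g :: "'b \<Rightarrow> 'c::enc"
  assumes "ptime g" "ptime f"
  shows "ptime (\<lambda>x. g (f x))"
proof -
  obtain p k where p: "\<And>a s. s 0 = enc a \<Longrightarrow>
     \<exists>s'. exec_within p s ((size_of a + val_size (s 1) + 2) ^ k) s' \<and> s' 0 = enc (f a) \<and> s' 1 = s 1"
    using assms(2) unfolding ptime_def by blast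
  obtain q l where q: "\<And>a s. s 0 = enc a \<Longrightarrow>
     \<exists>s'. exec_within q s ((size_of a + val_size (s 1) + 2) ^ l) s' \<and> s' 0 = enc (g a) \<and> s' 1 = s 1"
    using assms(1) unfolding ptime_def by blast
  let ?T = "\<lambda>(a, n). (size_of a + n + 2) ^ k + (size_of (f a) + n + 2) ^ l"
  show ?thesis
  proof (rule ptimeI[where p = "Seq p q" and T = ?T])
    fix a :: 'a and s :: state assume "s 0 = enc a"
    then obtain s1 where s1: "exec_within p s ((size_of a + val_size (s 1) + 2) ^ k) s1"
      "s1 0 = enc (f a)" "s1 1 = s 1"
      using p by blast
    then obtain s2 where s2: "exec_within q s1 ((size_of (f a) + val_size (s 1) + 2) ^ l) s2"
      "s2 0 = enc (g (f a))" "s2 1 = s 1"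
      using q by metis
    then show "\<exists>s'. exec_within (Seq p q) s (?T (a, val_size (s 1))) s' \<and> s' 0 = enc (g (f a)) \<and> s' 1 = s 1"
      using exec_within_Seq[OF s1(1) s2(1)] by auto
  next
    have 1: "poly_bounded (\<lambda>z::'a \<times> nat. size_of (fst z) + snd z) (\<lambda>z. size_of (fst z))"
      "poly_bounded (\<lambda>z::'a \<times> nat. size_of (fst z) + snd z) snd"
      by (rule poly_bounded_mono[OF poly_bounded_self], simp)+
    have 2: "poly_bounded (\<lambda>z::'a \<times> nat. size_of (fst z) + snd z) (\<lambda>z. size_of (f (fst z)))"
      by (rule poly_bounded_trans[OF 1(1)]) (rule poly_bounded_compose[OF ptime_size[OF assms(2)]])
    show "poly_bounded (\<lambda>(a::'a, n). size_of a + n) ?T"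
      unfolding case_prod_unfold by (intro poly_bounded_intros 1 2)
  qed
qed

lemma ptime_Pair:
  fixes f :: "'a::enc \<Rightarrow> 'b::enc" and g :: "'a \<Rightarrow> 'c::enc"
  assumes "ptime f" "ptime g"
  shows "ptime (\<lambda>x. (f x, g x))"
proof -
  obtain p k where p: "\<And>a s. s 0 = enc a \<Longrightarrow>
     \<exists>s'. exec_within p s ((size_of a + val_size (s 1) + 2) ^ k) s' \<and> s' 0 = enc (f a) \<and> s' 1 = s 1"
    using assms(1) unfolding ptime_def by blast
  obtain q l where q: "\<And>a s. s 0 = enc a \<Longrightarrow>
     \<exists>s'. exec_within q s ((size_of a + val_size (s 1) + 2) ^ l) s' \<and> s' 0 = enc (g a) \<and> s' 1 = s 1"
    using assms(2) unfolding ptime_def by blast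
  \<comment> \<open>\<open>x\<close> is pushed before \<open>p\<close> runs. Afterwards it returns
    to variable 0, and \<open>f x\<close> takes its place on the stack to wait for the result of
    \<open>q\<close>. Variable 2 is read again before \<open>q\<close> starts, so it does not matter
    which variables \<open>p\<close> and \<open>q\<close> overwrite.\<close>
  let ?c = "Seq (Assign 1 (Pair_exp (Var 0) (Var 1)))
     (Seq p
     (Seq (Assign 2 (Left (Var 1)))
     (Seq (Assign 1 (Pair_exp (Var 0) (Right (Var 1))))
     (Seq (Assign 0 (Var 2))
     (Seq q
     (Seq (Assign 0 (Pair_exp (Left (Var 1)) (Var 0)))
          (Assign 1 (Right (Var 1)))))))))"
  let ?T = "\<lambda>(a, n). 20 * (size_of a + size_of (f a) + size_of (g a) + n + 1) +
     ((size_of a + (size_of a + n + 1) + 2) ^ k + (size_of a + (size_of (f a) + n + 1) + 2) ^ l)"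
  show ?thesis
  proof (rule ptimeI[where p = ?c and T = ?T])
    fix a :: 'a and s :: state assume s: "s 0 = enc a"
    let ?s1 = "s(1 := Node (enc a) (s 1))"
    obtain s2 where s2: "exec_within p ?s1 ((size_of a + val_size (?s1 1) + 2) ^ k) s2"
      "s2 0 = enc (f a)" "s2 1 = Node (enc a) (s 1)"
      using p[of ?s1 a] s by auto
    let ?s5 = "s2(2 := enc a, 1 := Node (enc (f a)) (s 1), 0 := enc a)"
    obtain s6 where s6: "exec_within q ?s5 ((size_of a + val_size (?s5 1) + 2) ^ l) s6"
      "s6 0 = enc (g a)" "s6 1 = Node (enc (f a)) (s 1)"
      using q[of ?s5 a] by auto
    let ?s8 = "s6(0 := enc (f a, g a), 1 := s 1)"
    let ?d = "size_of a + size_of (f a) + size_of (g a) + val_size (s 1) + 1"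
    have e1: "exec_within (Assign 1 (Pair_exp (Var 0) (Var 1))) s (2 * ?d) ?s1"
      by (rule exec_within_AssignI) (simp_all add: s)
    have e3: "exec_within (Assign 2 (Left (Var 1))) s2 (2 * ?d) (s2(2 := enc a))"
      by (rule exec_within_AssignI) (use s2 in simp_all)
    have e4: "exec_within (Assign 1 (Pair_exp (Var 0) (Right (Var 1)))) (s2(2 := enc a)) (5 * ?d)
        (s2(2 := enc a, 1 := Node (enc (f a)) (s 1)))"
      by (rule exec_within_AssignI) (use s2 in simp_all)
    have e5: "exec_within (Assign 0 (Var 2)) (s2(2 := enc a, 1 := Node (enc (f a)) (s 1))) ?d ?s5"
      by (rule exec_within_AssignI) simp_all
    have e7: "exec_within (Assign 0 (Pair_exp (Left (Var 1)) (Var 0))) s6 (5 * ?d) (s6(0 := enc (f a, g a)))"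
      by (rule exec_within_AssignI) (use s6 in \<open>simp_all add: enc_prod_def\<close>)
    have e8: "exec_within (Assign 1 (Right (Var 1))) (s6(0 := enc (f a, g a))) (2 * ?d) ?s8"
      by (rule exec_within_AssignI) (use s6 in simp_all)
    have "exec_within ?c s (?T (a, val_size (s 1))) ?s8"
      by (rule exec_within_mono[OF exec_within_Seq[OF e1 exec_within_Seq[OF s2(1) exec_within_Seq[OF e3
        exec_within_Seq[OF e4 exec_within_Seq[OF e5 exec_within_Seq[OF s6(1) exec_within_Seq[OF e7 e8]]]]]]]]) simp
    then show "\<exists>s'. exec_within ?c s (?T (a, val_size (s 1))) s' \<and> s' 0 = enc (f a, g a) \<and> s' 1 = s 1"
      by (rule exI[of _ ?s8, OF conjI]) auto
  next
    let ?n = "\<lambda>z::'a \<times> nat. size_of (fst z) + snd z"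
    have 1: "poly_bounded ?n (\<lambda>z. size_of (fst z))" "poly_bounded ?n snd"
      by (rule poly_bounded_mono[OF poly_bounded_self], simp)+
    have 2: "poly_bounded ?n (\<lambda>z. size_of (f (fst z)))" "poly_bounded ?n (\<lambda>z. size_of (g (fst z)))"
      by (rule poly_bounded_trans[OF 1(1)], rule poly_bounded_compose[OF ptime_size], fact)+
    show "poly_bounded (\<lambda>(a::'a, n). size_of a + n) ?T"
      unfolding case_prod_unfold by (intro poly_bounded_intros 1 2)
  qed
qed

lemma ptime_If:
  fixes f g :: "'a::enc \<Rightarrow> 'b::enc"
  assumes "ptime b" "ptime f" "ptime g"
  shows "ptime (\<lambda>x. if b x then f x else g x)"
proof -
  obtain r j where r: "\<And>a s. s 0 = enc a \<Longrightarrow>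
     \<exists>s'. exec_within r s ((size_of a + val_size (s 1) + 2) ^ j) s' \<and> s' 0 = enc (b a) \<and> s' 1 = s 1"
    using assms(1) unfolding ptime_def by blast
  obtain p k where p: "\<And>a s. s 0 = enc a \<Longrightarrow>
     \<exists>s'. exec_within p s ((size_of a + val_size (s 1) + 2) ^ k) s' \<and> s' 0 = enc (f a) \<and> s' 1 = s 1"
    using assms(2) unfolding ptime_def by blast
  obtain q l where q: "\<And>a s. s 0 = enc a \<Longrightarrow>
     \<exists>s'. exec_within q s ((size_of a + val_size (s 1) + 2) ^ l) s' \<and> s' 0 = enc (g a) \<and> s' 1 = s 1"
    using assms(3) unfolding ptime_def by blast
  \<comment> \<open>The stack is popped before the branch, so \<open>p\<close> and \<open>q\<close>
    start with the original argument and stack; variable 2 carries the truth value across the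
    pop.\<close>
  let ?c = "Seq (Assign 1 (Pair_exp (Var 0) (Var 1)))
     (Seq r
     (Seq (Assign 2 (Var 0))
     (Seq (Assign 0 (Left (Var 1)))
     (Seq (Assign 1 (Right (Var 1)))
          (If (Var 2) p q)))))"
  let ?T = "\<lambda>(a, n). 20 * (size_of a + n + 1) +
     ((size_of a + (size_of a + n + 1) + 2) ^ j + (size_of a + n + 2) ^ k + (size_of a + n + 2) ^ l)"
  show ?thesis
  proof (rule ptimeI[where p = ?c and T = ?T])
    fix a :: 'a and s :: state assume s: "s 0 = enc a"
    let ?s1 = "s(1 := Node (enc a) (s 1))"
    obtain s2 where s2: "exec_within r ?s1 ((size_of a + val_size (?s1 1) + 2) ^ j) s2"
      "s2 0 = enc (b a)" "s2 1 = Node (enc a) (s 1)"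
      using r[of ?s1 a] s by auto
    let ?s5 = "s2(2 := enc (b a), 0 := enc a, 1 := s 1)"
    let ?B = "(size_of a + val_size (s 1) + 2) ^ k + (size_of a + val_size (s 1) + 2) ^ l"
    have "\<exists>s'. exec_within (If (Var 2) p q) ?s5 (cost_exp ?s5 (Var 2) + ?B) s' \<and>
        s' 0 = enc (if b a then f a else g a) \<and> s' 1 = s 1"
    proof (cases "b a")
      case True
      obtain s' where "exec_within p ?s5 ((size_of a + val_size (s 1) + 2) ^ k) s'"
        "s' 0 = enc (f a)" "s' 1 = s 1"
        using p[of ?s5 a] by auto
      then show ?thesis
        using True by (auto simp: enc_bool_def intro!: exI[of _ s'] exec_within_mono[OF exec_within_IfTrue])
    next
      case False
      obtain s' where "exec_within q ?s5 ((size_of a + val_size (s 1) + 2) ^ l) s'"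
        "s' 0 = enc (g a)" "s' 1 = s 1"
        using q[of ?s5 a] by auto
      then show ?thesis
        using False by (auto simp: enc_bool_def intro!: exI[of _ s'] exec_within_mono[OF exec_within_IfFalse])
    qed
    then obtain s' where s': "exec_within (If (Var 2) p q) ?s5 (cost_exp ?s5 (Var 2) + ?B) s'"
      "s' 0 = enc (if b a then f a else g a)" "s' 1 = s 1"
      by blast
    let ?d = "size_of a + val_size (s 1) + 1"
    have e1: "exec_within (Assign 1 (Pair_exp (Var 0) (Var 1))) s (2 * ?d) ?s1"
      by (rule exec_within_AssignI) (simp_all add: s)
    have e3: "exec_within (Assign 2 (Var 0)) s2 ?d (s2(2 := enc (b a)))"
      by (rule exec_within_AssignI) (use s2 in \<open>simp_all add: size_of_bool\<close>)
    have e4: "exec_within (Assign 0 (Left (Var 1))) (s2(2 := enc (b a))) (2 * ?d)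
        (s2(2 := enc (b a), 0 := enc a))"
      by (rule exec_within_AssignI) (use s2 in simp_all)
    have e5: "exec_within (Assign 1 (Right (Var 1))) (s2(2 := enc (b a), 0 := enc a)) (2 * ?d) ?s5"
      by (rule exec_within_AssignI) (use s2 in simp_all)
    have "exec_within ?c s (?T (a, val_size (s 1))) s'"
      by (rule exec_within_mono[OF exec_within_Seq[OF e1 exec_within_Seq[OF s2(1) exec_within_Seq[OF e3
        exec_within_Seq[OF e4 exec_within_Seq[OF e5 s'(1)]]]]]]) (simp add: size_of_bool)
    then show "\<exists>s'. exec_within ?c s (?T (a, val_size (s 1))) s' \<and>
        s' 0 = enc (if b a then f a else g a) \<and> s' 1 = s 1"
      using s' by blast
  next
    let ?n = "\<lambda>z::'a \<times> nat. size_of (fst z) + snd z"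
    have 1: "poly_bounded ?n (\<lambda>z. size_of (fst z))" "poly_bounded ?n snd"
      by (rule poly_bounded_mono[OF poly_bounded_self], simp)+
    show "poly_bounded (\<lambda>(a::'a, n). size_of a + n) ?T"
      unfolding case_prod_unfold by (intro poly_bounded_intros 1)
  qed
qed

fun const_exp :: "val \<Rightarrow> exp" where
  "const_exp (Num n) = Const n"
| "const_exp (Node a b) = Pair_exp (const_exp a) (const_exp b)"

lemma eval_const_exp: "eval_exp s (const_exp v) = v"
  by (induction v) auto

lemma cost_const_exp: "cost_exp s (const_exp v) = cost_exp s' (const_exp v)"
  by (induction v) (auto simp: eval_const_exp)

lemma ptime_const: "ptime (\<lambda>x. c)"
proof (rule ptime_exp[where e = "const_exp (enc c)" and c = "cost_exp (\<lambda>_. Num 0) (const_exp (enc c))"])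
  fix a :: 'a and s :: state
  show "cost_exp s (const_exp (enc c)) \<le> cost_exp (\<lambda>_. Num 0) (const_exp (enc c)) * (size_of a + 1)"
    using cost_const_exp[of s "enc c" "\<lambda>_. Num 0"] by simp
qed (rule eval_const_exp)

lemma ptime_fst:
  assumes "ptime f"
  shows "ptime (\<lambda>x. fst (f x))"
  by (rule ptime_comp[OF ptime_exp[where f = fst and e = "Left (Var 0)" and c = 2] assms])
    (auto simp: enc_prod_def)

lemma ptime_snd:
  assumes "ptime f"
  shows "ptime (\<lambda>x. snd (f x))"
  by (rule ptime_comp[OF ptime_exp[where f = snd and e = "Right (Var 0)" and c = 2] assms])
    (auto simp: enc_prod_def)

lemma ptime_binop:
  fixes h :: "'b::enc \<Rightarrow> 'c::enc \<Rightarrow> 'd::enc"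
  assumes "ptime f" "ptime g"
    and "\<And>x y s. s 0 = enc (x, y) \<Longrightarrow> eval_exp s e = enc (h x y)"
    and "\<And>(x::'b) (y::'c) s. s 0 = enc (x, y) \<Longrightarrow> cost_exp s e \<le> c * (size_of (x, y) + 1)"
  shows "ptime (\<lambda>x. h (f x) (g x))"
proof -
  have "ptime (\<lambda>p. h (fst p) (snd p))"
  proof (rule ptime_exp)
    fix p :: "'b \<times> 'c" and s :: state
    assume s: "s 0 = enc p"
    show "eval_exp s e = enc (h (fst p) (snd p))"
      by (rule assms(3)) (simp add: s)
    show "cost_exp s e \<le> c * (size_of p + 1)"
      using assms(4)[of s "fst p" "snd p"] s by simp
  qed
  from ptime_comp[OF this ptime_Pair[OF assms(1,2)]] show ?thesis by simp
qed

lemma ptime_add: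
  assumes "ptime f" "ptime g"
  shows "ptime (\<lambda>x. f x + g x :: nat)"
proof (rule ptime_binop[OF assms, where e = "Add (Left (Var 0)) (Right (Var 0))" and c = 10])
  fix x y :: nat and s :: state
  assume "s 0 = enc (x, y)"
  then show "cost_exp s (Add (Left (Var 0)) (Right (Var 0))) \<le> 10 * (size_of (x, y) + 1)"
    using floor_log_add_le[of x y] by (simp add: enc_prod_def enc_nat_def)
qed (simp add: enc_prod_def enc_nat_def)

lemma ptime_diff:
  assumes "ptime f" "ptime g"
  shows "ptime (\<lambda>x. f x - g x :: nat)"
proof (rule ptime_binop[OF assms, where e = "Sub (Left (Var 0)) (Right (Var 0))" and c = 10])
  fix x y :: nat and s :: state
  assume "s 0 = enc (x, y)"
  then show "cost_exp s (Sub (Left (Var 0)) (Right (Var 0))) \<le> 10 * (size_of (x, y) + 1)"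
    using floor_log_le[OF diff_le_self[of x y]] by (simp add: enc_prod_def enc_nat_def)
qed (simp add: enc_prod_def enc_nat_def)

lemma ptime_mult:
  assumes "ptime f" "ptime g"
  shows "ptime (\<lambda>x. f x * g x :: nat)"
proof (rule ptime_binop[OF assms, where e = "Mul (Left (Var 0)) (Right (Var 0))" and c = 10])
  fix x y :: nat and s :: state
  assume "s 0 = enc (x, y)"
  then show "cost_exp s (Mul (Left (Var 0)) (Right (Var 0))) \<le> 10 * (size_of (x, y) + 1)"
    using floor_log_mult_le[of x y] by (simp add: enc_prod_def enc_nat_def)
qed (simp add: enc_prod_def enc_nat_def)

lemma ptime_div:
  assumes "ptime f" "ptime g"
  shows "ptime (\<lambda>x. f x div g x :: nat)"
proof (rule ptime_binop[OF assms, where e = "Div (Left (Var 0)) (Right (Var 0))" and c = 10])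
  fix x y :: nat and s :: state
  assume "s 0 = enc (x, y)"
  then show "cost_exp s (Div (Left (Var 0)) (Right (Var 0))) \<le> 10 * (size_of (x, y) + 1)"
    using floor_log_le[OF div_le_dividend[of x y]] by (simp add: enc_prod_def enc_nat_def)
qed (simp add: enc_prod_def enc_nat_def)

lemma ptime_less: "ptime f \<Longrightarrow> ptime g \<Longrightarrow> ptime (\<lambda>x. f x < (g x :: nat))"
  by (erule ptime_binop[where e = "Less (Left (Var 0)) (Right (Var 0))" and c = 10])
    (auto simp: enc_prod_def enc_nat_def enc_bool_def)

lemma ptime_not:
  assumes "ptime f"
  shows "ptime (\<lambda>x. \<not> f x)"
proof -
  have "(\<lambda>x. \<not> f x) = (\<lambda>x. if f x then False else True)" by auto
  then show ?thesis by (simp only: ptime_If assms ptime_const)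
qed

lemma ptime_conj:
  assumes "ptime f" "ptime g"
  shows "ptime (\<lambda>x. f x \<and> g x)"
proof -
  have "(\<lambda>x. f x \<and> g x) = (\<lambda>x. if f x then g x else False)" by auto
  then show ?thesis by (simp only: ptime_If assms ptime_const)
qed

lemma ptime_le: "ptime f \<Longrightarrow> ptime g \<Longrightarrow> ptime (\<lambda>x. f x \<le> (g x :: nat))"
  using ptime_not[OF ptime_less[of g f]] by (simp add: not_less)

lemma ptime_eq: "ptime f \<Longrightarrow> ptime g \<Longrightarrow> ptime (\<lambda>x. f x = (g x :: nat))"
  using ptime_conj[OF ptime_le[of f g] ptime_le[of g f]] by (simp add: order_eq_iff)

lemma ptime_mod: "ptime f \<Longrightarrow> ptime g \<Longrightarrow> ptime (\<lambda>x. f x mod (g x :: nat))"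
  unfolding minus_div_mult_eq_mod[symmetric] by (intro ptime_diff ptime_mult ptime_div)

lemma ptime_Suc: "ptime f \<Longrightarrow> ptime (\<lambda>x. Suc (f x))"
  unfolding Suc_eq_plus1 by (intro ptime_add ptime_const)

lemma ptime_Cons: "ptime f \<Longrightarrow> ptime g \<Longrightarrow> ptime (\<lambda>x. f x # g x)"
  by (erule ptime_binop[where e = "Var 0" and c = 10]) (auto simp: enc_prod_def)

text \<open>The empty list is split off because the primitives read \<open>Num 0\<close> in their
  own way: \<open>Left\<close> yields \<open>Num 0\<close> there, whereas \<open>hd []\<close> is an
  unspecified value. Its encoding is built into the program as a constant.\<close>

lemma ptime_list_cases:
  fixes f :: "'a::enc list \<Rightarrow> 'b::enc"
  assumes "\<And>x xs s. s 0 = enc (x # xs) \<Longrightarrow> eval_exp s e = enc (f (x # xs))"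
    and "\<And>(x::'a) xs s. s 0 = enc (x # xs) \<Longrightarrow> cost_exp s e \<le> c * (size_of (x # xs) + 1)"
  shows "ptime f"
proof (rule ptimeI[where p = "If (Var 0) (Assign 0 e) (Assign 0 (const_exp (enc (f []))))"
      and T = "\<lambda>(xs, n). (c + 1 + cost_exp (\<lambda>_. Num 0) (const_exp (enc (f [])))) * (size_of xs + n + 1)"])
  fix xs :: "'a list" and s :: state
  let ?e = "const_exp (enc (f []))"
  let ?T = "(c + 1 + cost_exp (\<lambda>_. Num 0) ?e) * (size_of xs + val_size (s 1) + 1)"
  assume s: "s 0 = enc xs"
  have "exec_within (If (Var 0) (Assign 0 e) (Assign 0 ?e)) s ?T (s(0 := enc (f xs)))"
  proof (cases xs)
    case Nil
    have "exec_within (Assign 0 ?e) s (cost_exp (\<lambda>_. Num 0) ?e) (s(0 := enc (f xs)))"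
      using cost_const_exp[of s "enc (f [])" "\<lambda>_. Num 0"]
      by (intro exec_within_AssignI) (simp_all add: Nil eval_const_exp)
    then show ?thesis
      by (rule exec_within_mono[OF exec_within_IfFalse, rotated]) (use s Nil in \<open>simp_all add: algebra_simps\<close>)
  next
    case (Cons y ys)
    have "exec_within (Assign 0 e) s (c * (size_of xs + 1)) (s(0 := enc (f xs)))"
      using assms(1)[of s y ys] assms(2)[of s y ys] s Cons by (intro exec_within_AssignI) simp_all
    then show ?thesis
      by (rule exec_within_mono[OF exec_within_IfTrue, rotated])
        (use s Cons in \<open>simp_all add: algebra_simps\<close>)
  qed
  then show "\<exists>s'. exec_within (If (Var 0) (Assign 0 e) (Assign 0 ?e)) s
      (case (xs, val_size (s 1)) of (xs, n) \<Rightarrow>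
        (c + 1 + cost_exp (\<lambda>_. Num 0) ?e) * (size_of xs + n + 1)) s' \<and>
      s' 0 = enc (f xs) \<and> s' 1 = s 1"
    by (intro exI[of _ "s(0 := enc (f xs))"]) simp
next
  show "poly_bounded (\<lambda>(xs::'a list, n). size_of xs + n)
      (\<lambda>(xs, n). (c + 1 + cost_exp (\<lambda>_. Num 0) (const_exp (enc (f [])))) * (size_of xs + n + 1))"
    using poly_bounded_mult[OF poly_bounded_const[of _ "c + 1 + cost_exp (\<lambda>_. Num 0) (const_exp (enc (f [])))"]
        poly_bounded_add[OF poly_bounded_self poly_bounded_const[of _ 1]],
        of "\<lambda>(xs::'a list, n). size_of xs + n"]
    by (simp add: case_prod_unfold)
qed

lemma ptime_null: "ptime f \<Longrightarrow> ptime (\<lambda>x. f x = [])"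
  by (rule ptime_comp[OF ptime_list_cases[where e = "Const 0" and c = 1]]) (auto simp: enc_bool_def)

lemma ptime_hd: "ptime f \<Longrightarrow> ptime (\<lambda>x. hd (f x))"
  by (rule ptime_comp[OF ptime_list_cases[where e = "Left (Var 0)" and c = 2]]) auto

lemma ptime_tl: "ptime f \<Longrightarrow> ptime (\<lambda>x. tl (f x))"
  by (rule ptime_comp[OF ptime_list_cases[where e = "Right (Var 0)" and c = 2]]) auto

section \<open>Iteration over lists\<close>

text \<open>A polynomial step alone does not suffice, since a step that doubles its accumulator
  takes exponential time when iterated. Hence \<open>B\<close> bounds the accumulator after every
  prefix of the list.\<close>

lemma ptime_foldl_bounded:
  fixes i :: "'a::enc \<Rightarrow> 'b::enc" and l :: "'a \<Rightarrow> 'c::enc list" and g :: "'a \<Rightarrow> 'b \<Rightarrow> 'c \<Rightarrow> 'b"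
  assumes g: "ptime (\<lambda>z. g (fst z) (fst (snd z)) (snd (snd z)))"
    and i: "ptime i" and l: "ptime l"
    and B: "poly_bounded size_of B"
    and bound: "\<And>x ys zs. l x = ys @ zs \<Longrightarrow> size_of (foldl (g x) (i x) ys) \<le> B x"
  shows "ptime (\<lambda>x. foldl (g x) (i x) (l x))"
proof -
  obtain p k where p: "\<And>a s. s 0 = enc a \<Longrightarrow>
     \<exists>s'. exec_within p s ((size_of a + val_size (s 1) + 2) ^ k) s' \<and>
       s' 0 = enc (g (fst a) (fst (snd a)) (snd (snd a))) \<and> s' 1 = s 1"
    using g unfolding ptime_def by blast
  \<comment> \<open>Variable 0 holds \<open>(rest, (a, x))\<close>, so the loop test
    \<open>Left (Var 0)\<close> asks whether the rest is nonempty. The body saves this triple on the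
    stack, hands \<open>(x, (a, y))\<close> to \<open>p\<close>, and rebuilds the triple from the
    saved one and the new accumulator.\<close>
  let ?body = "Seq (Assign 1 (Pair_exp (Var 0) (Var 1)))
     (Seq (Assign 0 (Pair_exp (Right (Right (Var 0))) (Pair_exp (Left (Right (Var 0))) (Left (Left (Var 0))))))
     (Seq p
     (Seq (Assign 0 (Pair_exp (Right (Left (Left (Var 1)))) (Pair_exp (Var 0) (Right (Right (Left (Var 1)))))))
          (Assign 1 (Right (Var 1))))))"
  let ?loop = "While (Left (Var 0)) ?body"
  let ?c = "Seq ?loop (Assign 0 (Left (Right (Var 0))))"
  let ?init = "\<lambda>x. (l x, (i x, x))"
  \<comment> \<open>The factor 2 is there because, while \<open>p\<close> runs, the loop state lies
    on the stack and its components occur once more in the argument.\<close>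
  let ?M = "\<lambda>x n. 2 * (size_of (l x) + B x + size_of x + n + 10)"
  let ?T = "\<lambda>(x, n). size_of (l x) * (30 * ?M x n + ?M x n ^ k) + 20 * ?M x n"
  have loop: "\<exists>s'. exec_within ?loop s (length ys * (30 * ?M x n + ?M x n ^ k) + 2 * ?M x n) s' \<and>
      s' 0 = enc ([] :: 'c list, (foldl (g x) a ys, x)) \<and> s' 1 = s 1"
    if "s 0 = enc (ys, (a, x))" "val_size (s 1) = n" "size_of ys \<le> size_of (l x)"
      "\<And>us vs. ys = us @ vs \<Longrightarrow> size_of (foldl (g x) a us) \<le> B x" for s ys a x n
    using that
  proof (induction ys arbitrary: s a)
    case Nil
    have "exec_within ?loop s (cost_exp s (Left (Var 0))) s"
      by (rule exec_within_WhileFalse) (simp add: Nil enc_prod_def)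
    then show ?case
      using Nil Nil(4)[of "[]" "[]"]
      by (intro exI[of _ s]) (auto simp: Nil enc_prod_def elim!: exec_within_mono)
  next
    case (Cons y ys)
    let ?st = "enc (y # ys, (a, x))" and ?a = "g x a y"
    have sz: "size_of a \<le> B x" "size_of ?a \<le> B x"
      using Cons.prems(4)[of "[]" "y # ys"] Cons.prems(4)[of "[y]" "ys"] by auto
    have sz': "size_of y + size_of ys < size_of (l x)"
      using Cons.prems(3) by simp
    let ?s1 = "s(1 := Node ?st (s 1))"
    let ?s2 = "s(1 := Node ?st (s 1), 0 := enc (x, (a, y)))"
    have e1: "exec_within (Assign 1 (Pair_exp (Var 0) (Var 1))) s (2 * ?M x n) ?s1"
      by (rule exec_within_AssignI) (use sz sz' Cons.prems in simp_all)
    have e2: "exec_within (Assign 0 (Pair_exp (Right (Right (Var 0))) (Pair_exp (Left (Right (Var 0)))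
        (Left (Left (Var 0)))))) ?s1 (10 * ?M x n) ?s2"
      by (rule exec_within_AssignI) (use sz sz' Cons.prems in \<open>simp_all add: enc_prod_def\<close>)
    have "(size_of (x, (a, y)) + val_size (?s2 1) + 2) ^ k \<le> ?M x n ^ k"
      by (rule power_mono) (use sz sz' Cons.prems in \<open>simp_all\<close>)
    then obtain s3 where s3: "exec_within p ?s2 (?M x n ^ k) s3" "s3 0 = enc ?a" "s3 1 = Node ?st (s 1)"
      using p[of ?s2 "(x, (a, y))"] exec_within_mono by fastforce
    let ?s4 = "s3(0 := enc (ys, (?a, x)))"
    let ?s5 = "s3(0 := enc (ys, (?a, x)), 1 := s 1)"
    have e4: "exec_within (Assign 0 (Pair_exp (Right (Left (Left (Var 1)))) (Pair_exp (Var 0)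
        (Right (Right (Left (Var 1))))))) s3 (12 * ?M x n) ?s4"
      by (rule exec_within_AssignI) (use sz sz' Cons.prems s3 in \<open>simp_all add: enc_prod_def\<close>)
    have e5: "exec_within (Assign 1 (Right (Var 1))) ?s4 (2 * ?M x n) ?s5"
      by (rule exec_within_AssignI) (use sz sz' Cons.prems s3 in \<open>simp_all add: enc_prod_def\<close>)
    have body: "exec_within ?body s (26 * ?M x n + ?M x n ^ k) ?s5"
      by (rule exec_within_mono[OF exec_within_Seq[OF e1 exec_within_Seq[OF e2 exec_within_Seq[OF s3(1)
        exec_within_Seq[OF e4 e5]]]]]) simp
    have "size_of (foldl (g x) ?a us) \<le> B x" if "ys = us @ vs" for us vs
      using Cons.prems(4)[of "y # us" vs] that by simp
    then have "\<exists>s'. exec_within ?loop ?s5 (length ys * (30 * ?M x n + ?M x n ^ k) + 2 * ?M x n) s' \<and>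
        s' 0 = enc ([] :: 'c list, (foldl (g x) ?a ys, x)) \<and> s' 1 = ?s5 1"
      by (intro Cons.IH) (use Cons.prems in auto)
    then obtain s' where s': "exec_within ?loop ?s5 (length ys * (30 * ?M x n + ?M x n ^ k) + 2 * ?M x n) s'"
      "s' 0 = enc ([] :: 'c list, (foldl (g x) ?a ys, x))" "s' 1 = s 1"
      by auto
    have "exec_within ?loop s (length (y # ys) * (30 * ?M x n + ?M x n ^ k) + 2 * ?M x n) s'"
      by (rule exec_within_mono[OF exec_within_WhileTrue[OF _ body s'(1)]])
        (use sz sz' Cons.prems in \<open>simp_all add: enc_prod_def\<close>)
    then show ?case using s' by auto
  qed
  have init: "ptime ?init"
    by (intro ptime_Pair i l ptime_id)
  then obtain r j where r: "\<And>a s. s 0 = enc a \<Longrightarrow>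
     \<exists>s'. exec_within r s ((size_of a + val_size (s 1) + 2) ^ j) s' \<and> s' 0 = enc (?init a) \<and> s' 1 = s 1"
    unfolding ptime_def by blast
  let ?T = "\<lambda>(x, n). (size_of x + n + 2) ^ j +
      (size_of (l x) * (30 * ?M x n + ?M x n ^ k) + 2 * ?M x n + 10 * ?M x n)"
  show ?thesis
  proof (rule ptimeI[where p = "Seq r ?c" and T = ?T])
    fix x :: 'a and s :: state assume s: "s 0 = enc x"
    define n where "n = val_size (s 1)"
    obtain s1 where s1: "exec_within r s ((size_of x + n + 2) ^ j) s1" "s1 0 = enc (?init x)" "s1 1 = s 1"
      using r[where s = s and a = x] s unfolding n_def by blast
    have "\<exists>s'. exec_within ?loop s1 (length (l x) * (30 * ?M x n + ?M x n ^ k) + 2 * ?M x n) s' \<and>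
        s' 0 = enc ([] :: 'c list, (foldl (g x) (i x) (l x), x)) \<and> s' 1 = s1 1"
    proof (rule loop)
      show "s1 0 = enc (l x, (i x, x))" "val_size (s1 1) = n"
        using s1 by (simp_all add: n_def)
      show "\<And>us vs. l x = us @ vs \<Longrightarrow> size_of (foldl (g x) (i x) us) \<le> B x"
        by (rule bound)
    qed simp
    then obtain s2 where
      e2': "exec_within ?loop s1 (length (l x) * (30 * ?M x n + ?M x n ^ k) + 2 * ?M x n) s2"
      and s2: "s2 0 = enc ([] :: 'c list, (foldl (g x) (i x) (l x), x))" "s2 1 = s1 1"
      by blast
    from e2' have e2: "exec_within ?loop s1 (size_of (l x) * (30 * ?M x n + ?M x n ^ k) + 2 * ?M x n) s2"
      by (rule exec_within_mono) (intro add_right_mono mult_right_mono length_le_size_of zero_le)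
    have "size_of (foldl (g x) (i x) (l x)) \<le> B x"
      using bound[of x "l x" "[]"] by simp
    then have e3: "exec_within (Assign 0 (Left (Right (Var 0)))) s2 (10 * ?M x n)
        (s2(0 := enc (foldl (g x) (i x) (l x))))"
      by (intro exec_within_AssignI) (use s2 in \<open>simp_all add: enc_prod_def\<close>)
    show "\<exists>s'. exec_within (Seq r ?c) s (?T (x, val_size (s 1))) s' \<and>
        s' 0 = enc (foldl (g x) (i x) (l x)) \<and> s' 1 = s 1"
      using exec_within_Seq[OF s1(1) exec_within_Seq[OF e2 e3]] s1(3) s2(2)
      by (intro exI[of _ "s2(0 := enc (foldl (g x) (i x) (l x)))"] conjI) (simp_all only: n_def prod.case fun_upd_same, simp)
  next
    let ?n = "\<lambda>z::'a \<times> nat. size_of (fst z) + snd z"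
    have 1: "poly_bounded ?n (\<lambda>z. size_of (fst z))" "poly_bounded ?n snd"
      by (rule poly_bounded_mono[OF poly_bounded_self], simp)+
    have 2: "poly_bounded ?n (\<lambda>z. size_of (l (fst z)))" "poly_bounded ?n (\<lambda>z. B (fst z))"
      by (rule poly_bounded_trans[OF 1(1)], rule poly_bounded_compose[OF ptime_size[OF l]])
        (rule poly_bounded_trans[OF 1(1)], rule poly_bounded_compose[OF B])
    show "poly_bounded (\<lambda>(a::'a, n). size_of a + n) ?T"
      unfolding case_prod_unfold by (intro poly_bounded_intros 1 2)
  qed
qed

text \<open>The accumulator is split into a part that an invariant keeps below \<open>B\<close> and
  a part \<open>m\<close> that grows by at most \<open>h\<close> per step. As \<open>h\<close>
  depends on the input only, the total growth is at most the length of the list times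
  \<open>h\<close>.\<close>

lemma ptime_foldl:
  fixes i :: "'a::enc \<Rightarrow> 'b::enc" and l :: "'a \<Rightarrow> 'c::enc list" and g :: "'a \<Rightarrow> 'b \<Rightarrow> 'c \<Rightarrow> 'b"
  assumes g: "ptime (\<lambda>z. g (fst z) (fst (snd z)) (snd (snd z)))"
    and i: "ptime i" and l: "ptime l"
    and Inv: "\<And>x. Inv x (i x)" "\<And>x a y. Inv x a \<Longrightarrow> y \<in> set (l x) \<Longrightarrow> Inv x (g x a y)"
    and m: "\<And>x a. Inv x a \<Longrightarrow> size_of a \<le> B x + m x a"
    and h: "\<And>x a y. Inv x a \<Longrightarrow> y \<in> set (l x) \<Longrightarrow> m x (g x a y) \<le> m x a + h x"
    and polys: "poly_bounded size_of B" "poly_bounded size_of (\<lambda>x. m x (i x))" "poly_bounded size_of h"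
  shows "ptime (\<lambda>x. foldl (g x) (i x) (l x))"
proof (rule ptime_foldl_bounded[OF g i l, where B = "\<lambda>x. B x + (m x (i x) + size_of (l x) * h x)"])
  show "poly_bounded size_of (\<lambda>x. B x + (m x (i x) + size_of (l x) * h x))"
    by (intro poly_bounded_intros polys ptime_size l)
next
  fix x ys zs assume eq: "l x = ys @ zs"
  have "Inv x (foldl (g x) a ys) \<and> m x (foldl (g x) a ys) \<le> m x a + length ys * h x"
    if "Inv x a" "set ys \<subseteq> set (l x)" for a ys
    using that
  proof (induction ys arbitrary: a)
    case (Cons y ys)
    then have "Inv x (g x a y)" "m x (g x a y) \<le> m x a + h x"
      using Inv(2) h by auto
    then show ?case using Cons.IH[of "g x a y"] Cons.prems by auto
  qed auto
  then have inv: "Inv x (foldl (g x) (i x) ys)" and "m x (foldl (g x) (i x) ys) \<le> m x (i x) + length ys * h x"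
    using Inv(1) eq by auto
  moreover have "length ys \<le> size_of (l x)"
    using length_le_size_of[of "l x"] eq by simp
  then have "length ys * h x \<le> size_of (l x) * h x"
    by (rule mult_right_mono) simp
  ultimately show "size_of (foldl (g x) (i x) ys) \<le> B x + (m x (i x) + size_of (l x) * h x)"
    using m[OF inv] by linarith
qed

lemma ptime_foldl_grow:
  fixes i :: "'a::enc \<Rightarrow> 'b::enc" and l :: "'a \<Rightarrow> 'c::enc list" and g :: "'a \<Rightarrow> 'b \<Rightarrow> 'c \<Rightarrow> 'b"
  assumes "ptime (\<lambda>z. g (fst z) (fst (snd z)) (snd (snd z)))" "ptime i" "ptime l"
    and "\<And>x a y. y \<in> set (l x) \<Longrightarrow> size_of (g x a y) \<le> size_of a + h x"
    and "poly_bounded size_of h"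
  shows "ptime (\<lambda>x. foldl (g x) (i x) (l x))"
  by (rule ptime_foldl[where Inv = "\<lambda>_ _. True" and B = "\<lambda>_. 0" and m = "\<lambda>_. size_of" and h = h])
    (auto simp: assms poly_bounded_const ptime_size)

section \<open>List operations and sorting\<close>

lemma ptime_rev:
  assumes "ptime f"
  shows "ptime (\<lambda>x. rev (f x))"
proof -
  have "ptime (\<lambda>x. foldl (\<lambda>a y. y # a) [] (f x))"
    by (rule ptime_foldl_grow[where h = "\<lambda>x. Suc (size_of (f x))"])
      (auto intro!: ptime_Cons ptime_fst ptime_snd ptime_id ptime_const assms poly_bounded_intros ptime_size
        poly_bounded_add[OF poly_bounded_const[of _ 1], simplified] dest: size_of_mem)
  then show ?thesis by (simp add: foldl_conv_fold rev_conv_fold)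
qed

lemma size_of_append: "Suc (size_of (xs @ ys)) = size_of xs + size_of ys"
  by (induction xs) auto

lemma ptime_append:
  assumes "ptime f" "ptime g"
  shows "ptime (\<lambda>x. f x @ g x)"
proof -
  have "ptime (\<lambda>x. foldl (\<lambda>a y. y # a) (g x) (rev (f x)))"
    by (rule ptime_foldl_grow[where h = "\<lambda>x. Suc (size_of (f x))"])
      (auto intro!: ptime_Cons ptime_fst ptime_snd ptime_id ptime_const ptime_rev assms poly_bounded_intros
        ptime_size poly_bounded_add[OF poly_bounded_const[of _ 1], simplified] dest: size_of_mem)
  moreover have "foldl (\<lambda>a y. y # a) b (rev xs) = xs @ b" for xs b :: "'b list"
    by (induction xs arbitrary: b) auto
  ultimately show ?thesis by simp
qed

lemma ptime_map:
  assumes "ptime (\<lambda>z. h (fst z) (snd z))" "ptime l"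
  shows "ptime (\<lambda>x. map (h x) (l x))"
proof -
  obtain k where k: "\<And>z. size_of (h (fst z) (snd z)) \<le> (size_of z + 2) ^ k"
    using ptime_size[OF assms(1)] unfolding poly_bounded_def by blast
  let ?H = "\<lambda>x. 1 + (1 + (size_of x + size_of (l x)) + 2) ^ k"
  have H: "poly_bounded size_of ?H"
    by (intro poly_bounded_intros poly_bounded_self ptime_size assms)
  have grow: "size_of (h x y # a) \<le> size_of a + ?H x" if "y \<in> set (l x)" for x y a
  proof -
    have "size_of (h x y) \<le> (size_of (x, y) + 2) ^ k" using k[of "(x, y)"] by simp
    also have "\<dots> \<le> (1 + (size_of x + size_of (l x)) + 2) ^ k"
      by (rule power_mono) (use size_of_mem[OF that] in auto)
    finally show ?thesis by simp
  qed
  have "ptime (\<lambda>x. foldl (\<lambda>a y. h x y # a) [] (l x))"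
    by (rule ptime_foldl_grow[where h = ?H, OF _ _ _ grow H])
      (auto intro!: ptime_Cons ptime_fst ptime_snd ptime_id ptime_const assms
         ptime_comp[OF assms(1), of "\<lambda>z. (fst z, snd (snd z))", simplified] ptime_Pair)
  then have "ptime (\<lambda>x. rev (foldl (\<lambda>a y. h x y # a) [] (l x)))"
    by (rule ptime_rev)
  moreover have "rev (foldl (\<lambda>a y. h x y # a) b xs) = rev b @ map (h x) xs" for x xs b
    by (induction xs arbitrary: b) auto
  ultimately show ?thesis by simp
qed

lemma ptime_filter:
  assumes "ptime (\<lambda>z. p (fst z) (snd z))" "ptime l"
  shows "ptime (\<lambda>x. filter (p x) (l x))"
proof -
  have "ptime (\<lambda>x. foldl (\<lambda>a y. if p x y then y # a else a) [] (l x))"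
    by (rule ptime_foldl_grow[where h = "\<lambda>x. Suc (size_of (l x))"])
      (auto intro!: ptime_If ptime_Cons ptime_fst ptime_snd ptime_id ptime_const assms poly_bounded_intros
        ptime_comp[OF assms(1), of "\<lambda>z. (fst z, snd (snd z))", simplified] ptime_Pair
        ptime_size poly_bounded_add[OF poly_bounded_const[of _ 1], simplified] dest: size_of_mem)
  then have "ptime (\<lambda>x. rev (foldl (\<lambda>a y. if p x y then y # a else a) [] (l x)))"
    by (rule ptime_rev)
  moreover have "rev (foldl (\<lambda>a y. if p x y then y # a else a) b xs) = rev b @ filter (p x) xs" for x xs b
    by (induction xs arbitrary: b) auto
  ultimately show ?thesis by simp
qed

lemma size_of_Suc_le: "size_of (Suc n) \<le> Suc (size_of n)"
  using floor_log_add_le[of 1 n] by simp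

lemma poly_bounded_Suc: "poly_bounded n g \<Longrightarrow> poly_bounded n (\<lambda>x. Suc (g x))"
  unfolding Suc_eq_plus1 by (intro poly_bounded_add poly_bounded_const)

lemma ptime_length:
  assumes "ptime f"
  shows "ptime (\<lambda>x. length (f x))"
proof -
  have "ptime (\<lambda>x. foldl (\<lambda>n y. Suc n) 0 (f x))"
    by (rule ptime_foldl_grow[where h = "\<lambda>x. 1"])
      (use size_of_Suc_le in \<open>auto intro!: ptime_Suc ptime_fst ptime_snd ptime_id ptime_const assms poly_bounded_const\<close>)
  moreover have "foldl (\<lambda>n y. Suc n) m xs = m + length xs" for m and xs :: "'b list"
    by (induction xs arbitrary: m) auto
  ultimately show ?thesis by simp
qed

lemmas ptime_basic =
  ptime_id ptime_const ptime_fst ptime_snd ptime_Pair ptime_If ptime_add ptime_diff ptime_mult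
  ptime_div ptime_mod ptime_less ptime_le ptime_eq ptime_not ptime_conj ptime_Suc ptime_Cons ptime_null ptime_hd
  ptime_tl ptime_rev ptime_append ptime_map ptime_filter ptime_length

lemma floor_log_le_self: "floor_log n \<le> n"
proof (cases "n = 0")
  case False
  then show ?thesis
    using floor_log_exp2_le[of n] less_exp[of "floor_log n"] by linarith
qed simp

lemma size_of_rev [simp]: "size_of (rev xs) = size_of xs"
proof (induction xs)
  case (Cons x xs)
  then show ?case using size_of_append[of "rev xs" "[x]"] by simp
qed simp

text \<open>Each index is charged its value instead of its binary length. This is still polynomial,
  because indices are bounded by the length of the list and the start.\<close>

lemma size_of_enumerate:
  "size_of (List.enumerate n xs) \<le> size_of xs + length xs * (n + length xs + 3)"
proof (induction xs arbitrary: n)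
  case (Cons x xs)
  then show ?case
    using Cons.IH[of "Suc n"] floor_log_le_self[of n] by (simp add: algebra_simps)
qed simp

lemma ptime_enumerate:
  fixes f :: "'a::enc \<Rightarrow> 'b::enc list"
  assumes "ptime f"
  shows "ptime (\<lambda>x. List.enumerate 0 (f x))"
proof -
  let ?g = "\<lambda>a y. (length a, y) # a"
  let ?B = "\<lambda>x. size_of (f x) + size_of (f x) * (size_of (f x) + 3)"
  have foldl: "foldl ?g [] ys = rev (List.enumerate 0 ys)" for ys :: "'b list"
    by (induction ys rule: rev_induct) (auto simp: enumerate_append_eq)
  have "ptime (\<lambda>x. foldl ?g [] (f x))"
  proof (rule ptime_foldl_bounded[where B = ?B])
    fix x ys zs assume eq: "f x = ys @ zs"
    have "size_of (foldl ?g [] ys) \<le> size_of ys + length ys * (length ys + 3)"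
      using size_of_enumerate[of 0 ys] by (simp add: foldl)
    also have "\<dots> \<le> ?B x"
      using size_of_append[of ys zs] size_of_pos[of zs] length_le_size_of[of ys]
      unfolding eq by (intro add_mono mult_mono) linarith+
    finally show "size_of (foldl ?g [] ys) \<le> ?B x" .
  qed (intro ptime_basic poly_bounded_intros ptime_size assms)+
  then have "ptime (\<lambda>x. rev (foldl ?g [] (f x)))"
    by (rule ptime_rev)
  then show ?thesis by (simp add: foldl)
qed

definition stride :: "nat \<Rightarrow> nat \<Rightarrow> 'a list \<Rightarrow> 'a list" where
  "stride L k xs = map snd (filter (\<lambda>e. fst e mod L = k) (List.enumerate 0 xs))"

text \<open>The definition by enumeration is the form with a \<open>ptime\<close> rule;
  \<open>nths\<close> is the form for reasoning, where appending in front is a shift of the index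
  set.\<close>

lemma stride_eq_nths: "stride L k xs = nths xs {p. p mod L = k}"
  unfolding stride_def
  by (induction xs rule: rev_induct) (auto simp: enumerate_append_eq nths_append)

lemma ptime_stride:
  assumes "ptime f" "ptime g" "ptime h"
  shows "ptime (\<lambda>x. stride (f x) (g x) (h x))"
  unfolding stride_def
  by (intro ptime_basic ptime_enumerate assms ptime_comp[OF assms(1)] ptime_comp[OF assms(2)])

text \<open>Insertion sort as a left fold whose step consists of \<open>filter\<close> and append,
  for which \<open>ptime\<close> rules are at hand. Each step adds one element, which is the growth
  that \<open>ptime_foldl_grow\<close> allows.\<close>

definition isort :: "('a \<Rightarrow> nat) \<Rightarrow> 'a list \<Rightarrow> 'a list" where
  "isort key xs = foldl (\<lambda>a x. filter (\<lambda>y. key y \<le> key x) a @ x # filter (\<lambda>y. key x < key y) a) [] xs"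

lemma size_of_filter:
  "size_of (filter (\<lambda>y. key y \<le> (c::nat)) xs) + size_of (filter (\<lambda>y. c < key y) xs) = Suc (size_of xs)"
  by (induction xs) auto

lemma ptime_isort:
  assumes "ptime key" "ptime f"
  shows "ptime (\<lambda>x. isort key (f x))"
proof -
  let ?g = "\<lambda>a x. filter (\<lambda>y. key y \<le> key x) a @ x # filter (\<lambda>y. key x < key y) a"
  have "size_of (?g a y) \<le> size_of a + Suc (size_of (f x))" if "y \<in> set (f x)" for x a y
    using size_of_append[of "filter (\<lambda>z. key z \<le> key y) a" "y # filter (\<lambda>z. key y < key z) a"]
      size_of_filter[of key "key y" a] size_of_mem[OF that] by simp
  then show ?thesis
    unfolding isort_def
    by (intro ptime_foldl_grow[where h = "\<lambda>x. Suc (size_of (f x))"])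
      (auto intro!: ptime_basic ptime_comp[OF assms(1)] assms(2) poly_bounded_Suc ptime_size)
qed

lemma mset_isort [simp]: "mset (isort key xs) = mset xs"
  unfolding isort_def
proof (induction xs rule: rev_induct)
  case (snoc x xs)
  have "{#y \<in># M. key y \<le> key x#} + {#y \<in># M. key x < key y#} = M" for M
    using multiset_partition[of M "\<lambda>y. key y \<le> key x"] by (simp add: not_le)
  then show ?case using snoc by simp
qed simp

lemma set_isort [simp]: "set (isort key xs) = set xs"
  using mset_eq_setD[OF mset_isort] .

lemma distinct_isort [simp]: "distinct (isort key xs) = distinct xs"
  using mset_eq_imp_distinct_iff[OF mset_isort] .

lemma sorted_isort: "sorted (map key (isort key xs))"
proof -
  have "sorted (map key (filter (\<lambda>y. key y \<le> key x) a @ x # filter (\<lambda>y. key x < key y) a))"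
    if "sorted (map key a)" for x a
    using that by (auto simp: sorted_append sorted_filter)
  then have "sorted (map key a) \<Longrightarrow> sorted (map key (foldl (\<lambda>a x. filter (\<lambda>y. key y \<le> key x) a @ x # filter (\<lambda>y. key x < key y) a) a xs))" for a
    by (induction xs arbitrary: a) simp_all
  then show ?thesis unfolding isort_def by simp
qed

section \<open>The algorithm\<close>

text \<open>The first component of a job or a machine is its position in the input. It keeps items
  with equal data apart, so that sets and \<open>distinct\<close> can be used throughout.\<close>

type_synonym job = "nat \<times> nat"
type_synonym machine = "nat \<times> nat \<times> nat"
type_synonym allocation = "(job \<times> machine) list"

abbreviation dem :: "machine \<Rightarrow> nat" where "dem M \<equiv> fst (snd M)"
abbreviation slots :: "machine \<Rightarrow> nat" where "slots M \<equiv> snd (snd M)"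

text \<open>The test \<open>d \<le> w * \<beta>\<close> expresses the target
  \<open>d / \<beta>\<close> without division. On a sorted list the jobs handed out are the smallest
  ones.\<close>

definition fill :: "nat \<Rightarrow> nat \<Rightarrow> machine \<Rightarrow> job list \<Rightarrow> allocation \<Rightarrow> nat \<times> allocation \<times> job list" where
  "fill \<beta> d M ys A =
     foldl (\<lambda>(w, A, rs) y. if d \<le> w * \<beta> then (w, A, rs @ [y]) else (w + snd y, (y, M) # A, rs)) (0, A, []) ys"

text \<open>On success the ineligible jobs are dropped together with the used ones: machines come by
  decreasing slots, so a job that is too small now is too small for all later machines of the class.
  On failure the partial filling is discarded and its jobs stay available.\<close>

definition serve :: "nat \<Rightarrow> nat \<Rightarrow> job list \<times> job list \<times> allocation \<Rightarrow> machine \<Rightarrow>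
    job list \<times> job list \<times> allocation" where
  "serve \<beta> d st M = (case st of (ys, U, A) \<Rightarrow>
     case fill \<beta> d M (filter (\<lambda>y. d \<le> 2 * slots M * snd y) ys) A of (w, A', rs) \<Rightarrow>
       if d \<le> w * \<beta> then (rs, U, A')
       else if U = [] then st
       else (ys, tl U, (hd U, M) # A))"

definition class_of :: "machine list \<Rightarrow> nat \<Rightarrow> machine list" where
  "class_of ms d = rev (isort (\<lambda>M. slots M) (filter (\<lambda>M. d \<le> dem M \<and> dem M \<le> 2 * d) ms))"

text \<open>
  In the state \<open>(k, S, U, A)\<close>, the list \<open>S\<close> holds the jobs that are small for all classes from now
  on, including those already allocated, and \<open>U\<close> the other jobs still available.
\<close>

definition serve_class :: "nat \<Rightarrow> machine list \<Rightarrow> nat \<times> job list \<times> job list \<times> allocation \<Rightarrow> nat \<Rightarrow>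
    nat \<times> job list \<times> job list \<times> allocation" where
  "serve_class L ms st d = (case st of (k, S, U, A) \<Rightarrow>
     let S' = S @ filter (\<lambda>y. snd y * (8 * L) < d) U;
         r = foldl (serve (8 * L) d) (stride L k S', filter (\<lambda>y. \<not> snd y * (8 * L) < d) U, A) (class_of ms d)
     in (Suc k, S', snd r))"

definition class_starts :: "machine list \<Rightarrow> nat list" where
  "class_starts ms = rev (foldl (\<lambda>ds M. if ds = [] then [dem M] else if 2 * hd ds < dem M then dem M # ds else ds)
     [] (isort (\<lambda>M. dem M) ms))"

definition allocate :: "machine list \<Rightarrow> job list \<Rightarrow> allocation" where
  "allocate ms js = snd (snd (snd (foldl (serve_class (length (class_starts ms)) ms)
     (0, [], isort (\<lambda>y. snd y) js, []) (class_starts ms))))"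

section \<open>Approximation guarantee\<close>

abbreviation weight :: "job list \<Rightarrow> nat" where
  "weight ys \<equiv> sum_list (map snd ys)"

definition load :: "allocation \<Rightarrow> machine \<Rightarrow> job set" where
  "load N M = {y. (y, M) \<in> set N}"

text \<open>The target refers to the start \<open>d\<close> of the class, common to all its
  machines; the step to the demand is made once, in \<open>allocate_correct\<close>.\<close>

definition served :: "nat \<Rightarrow> nat \<Rightarrow> allocation \<Rightarrow> machine \<Rightarrow> bool" where
  "served \<beta> d N M \<longleftrightarrow> d \<le> sum snd (load N M) * \<beta> \<and> card (load N M) \<le> slots M"

text \<open>A solution as a family of disjoint job sets: it restricts to fewer machines at once, and
  an injection of jobs carries it to another solution by taking images.\<close>

definition satisfiable :: "machine set \<Rightarrow> job set \<Rightarrow> bool" where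
  "satisfiable Ms J \<longleftrightarrow> (\<exists>X.
     (\<forall>M\<in>Ms. X M \<subseteq> J \<and> card (X M) \<le> slots M \<and> dem M \<le> sum snd (X M)) \<and>
     (\<forall>M\<in>Ms. \<forall>M'\<in>Ms. M \<noteq> M' \<longrightarrow> X M \<inter> X M' = {}))"

lemma load_append: "load (N @ N') M = load N M \<union> load N' M"
  by (auto simp: load_def)

lemma load_eq_empty: "M \<notin> snd ` set N \<Longrightarrow> load N M = {}"
  by (force simp: load_def)

section \<open>Serving one class greedily\<close>

text \<open>Filling stops at the first prefix that reaches the target, so without its last job the
  prefix misses it. This limits the overshoot to a single job.\<close>

lemma fill_spec:
  "\<exists>tk rs. ys = tk @ rs \<and> fill \<beta> d M ys A = (weight tk, rev (map (\<lambda>y. (y, M)) tk) @ A, rs) \<and>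
     (tk = [] \<or> weight (butlast tk) * \<beta> < d) \<and> (d \<le> weight ys * \<beta> \<longrightarrow> d \<le> weight tk * \<beta>)"
proof -
  let ?g = "\<lambda>(w, A, rs) y. if d \<le> w * \<beta> then (w, A, rs @ [y]) else (w + snd y, (y, M) # A, rs)"
  have full: "foldl ?g (w, A, rs) ys = (w, A, rs @ ys)" if "d \<le> w * \<beta>" for w A rs ys
    using that by (induction ys arbitrary: rs) auto
  have "\<exists>tk rs. ys = tk @ rs \<and> foldl ?g (w, A, []) ys = (w + weight tk, rev (map (\<lambda>y. (y, M)) tk) @ A, rs) \<and>
     (tk = [] \<or> (w + weight (butlast tk)) * \<beta> < d) \<and>
     (d \<le> (w + weight ys) * \<beta> \<longrightarrow> d \<le> (w + weight tk) * \<beta>)" for w ys A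
  proof (induction ys arbitrary: w A)
    case (Cons y ys)
    show ?case
    proof (cases "d \<le> w * \<beta>")
      case True
      then show ?thesis
        by (intro exI[of _ "[]"] exI[of _ "y # ys"]) (simp add: full)
    next
      case False
      obtain tk rs where tk: "ys = tk @ rs"
        "foldl ?g (w + snd y, (y, M) # A, []) ys = (w + snd y + weight tk, rev (map (\<lambda>y. (y, M)) tk) @ (y, M) # A, rs)"
        "tk = [] \<or> (w + snd y + weight (butlast tk)) * \<beta> < d"
        "d \<le> (w + snd y + weight ys) * \<beta> \<longrightarrow> d \<le> (w + snd y + weight tk) * \<beta>"
        using Cons.IH[of "w + snd y" "(y, M) # A"] by blast
      then show ?thesis
        using False by (intro exI[of _ "y # tk"] exI[of _ rs]) (auto simp: add.assoc)
    qed
  qed simp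
  from this[of ys 0 A] show ?thesis unfolding fill_def by simp
qed

lemma weight_butlast:
  assumes "tk \<noteq> []"
  shows "weight tk = weight (butlast tk) + snd (last tk)"
  using arg_cong[OF append_butlast_last_id[OF assms], of weight] by simp

text \<open>All jobs taken but the last weigh less than \<open>d / \<beta>\<close> together, and the
  last one is small, whence the bound \<open>2 * d\<close>. Since each of them weighs at least
  \<open>d / (2 * slots M)\<close>, there are fewer than \<open>2 * slots M / \<beta>\<close>, that
  is, fewer than a quarter of the slots, before the last one. So eligibility enforces the
  cardinality constraint.\<close>

lemma serve_cases:
  assumes M: "0 < slots M" and \<beta>: "8 \<le> \<beta>" and d: "0 < d" and small: "\<forall>y\<in>set ys. snd y * \<beta> < d"
  defines "zs \<equiv> filter (\<lambda>y. d \<le> 2 * slots M * snd y) ys"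
  obtains (filled) tk rs where "zs = tk @ rs" "serve \<beta> d (ys, U, A) M = (rs, U, rev (map (\<lambda>y. (y, M)) tk) @ A)"
      "d \<le> weight tk * \<beta>" "weight tk * \<beta> \<le> 2 * d" "length tk \<le> slots M"
    | (unfilled) "weight zs * \<beta> < d"
      "serve \<beta> d (ys, U, A) M = (if U = [] then (ys, U, A) else (ys, tl U, (hd U, M) # A))"
proof -
  obtain tk rs where tk: "zs = tk @ rs" "fill \<beta> d M zs A = (weight tk, rev (map (\<lambda>y. (y, M)) tk) @ A, rs)"
    "tk = [] \<or> weight (butlast tk) * \<beta> < d" "d \<le> weight zs * \<beta> \<longrightarrow> d \<le> weight tk * \<beta>"
    using fill_spec by blast
  show thesis
  proof (cases "d \<le> weight tk * \<beta>")
    case True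
    then have ne: "tk \<noteq> []" using d by auto
    then have bl: "weight (butlast tk) * \<beta> < d" using tk by simp
    have "last tk \<in> set zs" using ne tk(1) by simp
    then have "snd (last tk) * \<beta> < d" using small by (simp add: zs_def)
    then have "weight tk * \<beta> \<le> 2 * d"
      using bl weight_butlast[OF ne] by (simp add: algebra_simps)
    moreover have "length tk \<le> slots M"
    proof -
      have "length us * d \<le> 2 * slots M * weight us" if "set us \<subseteq> set zs" for us
        using that by (induction us) (auto simp: zs_def algebra_simps)
      moreover have "set (butlast tk) \<subseteq> set zs"
        using tk(1) in_set_butlastD by fastforce
      ultimately have "(length tk - 1) * d \<le> 2 * slots M * weight (butlast tk)"
        by (metis length_butlast)
      then have "(length tk - 1) * d * \<beta> \<le> 2 * slots M * (weight (butlast tk) * \<beta>)"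
        by (metis mult.assoc mult_le_mono1)
      also have "\<dots> < 2 * slots M * d" using bl M by simp
      finally have "(length tk - 1) * \<beta> < 2 * slots M"
        using d by (metis mult.assoc mult.commute mult_less_cancel2)
      moreover have "(length tk - 1) * 8 \<le> (length tk - 1) * \<beta>" using \<beta> by simp
      ultimately show ?thesis by linarith
    qed
    ultimately show thesis
      using filled[of tk rs] tk True unfolding serve_def zs_def by simp
  next
    case False
    then show thesis
      using unfilled tk unfolding serve_def zs_def by simp
  qed
qed

lemma sum_weight: "distinct ys \<Longrightarrow> sum snd (set ys) = weight ys"
  by (simp add: sum_list_distinct_conv_sum_set)

lemma filter_sorted_suffix:
  assumes "sorted (map snd xs)" "\<And>y z. P y \<Longrightarrow> snd y \<le> snd z \<Longrightarrow> P z"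
  shows "\<exists>pre. xs = pre @ filter P xs \<and> (\<forall>y\<in>set pre. \<not> P y)"
  using assms(1)
proof (induction xs)
  case (Cons x xs)
  show ?case
  proof (cases "P x")
    case True
    then have "\<forall>y\<in>set xs. P y" using Cons.prems assms(2)[of x] by auto
    then show ?thesis using True by (intro exI[of _ "[]"]) simp
  next
    case False
    then obtain pre where "xs = pre @ filter P xs \<and> (\<forall>y\<in>set pre. \<not> P y)"
      using Cons by auto
    then show ?thesis using False by (intro exI[of _ "x # pre"]) simp
  qed
qed simp

text \<open>
  In \<open>hall\<close>, \<open>q\<close> is the number of machines that some solution serves by small jobs alone. That
  bound survives a step of the greedy because the machine at hand takes the smallest eligible jobs,
  of weight at most \<open>2 * d / \<beta>\<close>: as soon as it takes a job eligible for a later machine, all the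
  remaining jobs are.
\<close>

lemma serve_foldl:
  assumes "sorted (map snd ys)" "distinct (ys @ U)" "\<forall>y\<in>set ys. snd y * \<beta> < d"
    and "sorted_wrt (\<lambda>M M'. slots M' \<le> slots M) Ms" "distinct Ms" "\<forall>M\<in>set Ms. 0 < slots M"
    and "\<forall>y\<in>set U. d \<le> snd y * \<beta>" and "8 \<le> \<beta>" "0 < d"
    and "q \<le> length Ms" "length Ms - q \<le> length U"
    and hall: "\<forall>g<q. 2 * d * (q - g) \<le> weight (filter (\<lambda>y. d \<le> 2 * slots (Ms ! g) * snd y) ys) * \<beta>"
  shows "\<exists>b N ys'. b \<le> length Ms - q \<and> foldl (serve \<beta> d) (ys, U, A) Ms = (ys', drop b U, N @ A) \<and>
     distinct (map fst N) \<and> fst ` set N \<subseteq> set ys \<union> set (take b U) \<and> snd ` set N \<subseteq> set Ms \<and>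
     (\<forall>M\<in>set Ms. served \<beta> d N M)"
  using assms
proof (induction Ms arbitrary: ys U A q)
  case Nil
  then show ?case by (intro exI[of _ 0] exI[of _ "[]"] exI[of _ ys]) simp
next
  case (Cons M Ms)
  let ?E = "\<lambda>M. filter (\<lambda>y. d \<le> 2 * slots M * snd y)"
  have slots: "\<forall>M'\<in>set Ms. slots M' \<le> slots M" using Cons.prems(4) by simp
  have "0 < slots M" using Cons.prems(6) by simp
  from this Cons.prems(8,9,3) show ?case
  proof (cases rule: serve_cases[where U = U and A = A])
    case (filled tk rs)
    have sub: "set tk \<union> set rs \<subseteq> set ys"
      using arg_cong[OF filled(1), of set] by auto
    have srt: "sorted (map snd (tk @ rs))" and dst: "distinct (tk @ rs)"
      using Cons.prems(1,2) unfolding filled(1)[symmetric] by (simp_all add: sorted_filter)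
    have hall': "2 * d * (q - 1 - g) \<le> weight (?E (Ms ! g) rs) * \<beta>" if g: "g < q - 1" for g
    proof (cases "?E (Ms ! g) tk = []")
      \<comment> \<open>No job eligible for \<open>Ms ! g\<close> was taken, so its eligible jobs
        are the same as before. The old condition at \<open>Suc g\<close> is then the new one at
        \<open>g\<close>, since \<open>q\<close> and the index both drop by one.\<close>
      case True
      have "g < length Ms" using g Cons.prems(10) by simp
      then have "slots (Ms ! g) \<le> slots M" using slots by simp
      then have "d \<le> 2 * slots (Ms ! g) * snd y \<Longrightarrow> d \<le> 2 * slots M * snd y" for y
        by (meson le_trans mult_le_mono1 mult_le_mono2)
      then have "?E (Ms ! g) ys = ?E (Ms ! g) (?E M ys)"
        by (auto simp: filter_filter intro!: filter_cong)
      also have "\<dots> = ?E (Ms ! g) rs" by (simp add: filled(1) True)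
      finally have "?E (Ms ! g) ys = ?E (Ms ! g) rs" .
      then show ?thesis
        using Cons.prems(12) g by (auto dest: spec[of _ "Suc g"] simp: less_diff_conv)
    next
      case False
      then obtain y where y: "y \<in> set tk" "d \<le> 2 * slots (Ms ! g) * snd y"
        by (auto simp: filter_empty_conv)
      have "d \<le> 2 * slots (Ms ! g) * snd z" if "z \<in> set rs" for z
      proof -
        have "snd y \<le> snd z" using srt y(1) that by (auto simp: sorted_append)
        then show ?thesis using y(2) by (meson le_trans mult_le_mono2)
      qed
      then have E: "?E (Ms ! g) rs = rs" by simp
      \<comment> \<open>The condition at index 0 concerns \<open>M\<close> itself and has the
        largest left-hand side. After subtracting the at most \<open>2 * d\<close> that
        \<open>tk\<close> contributes, it still covers every later index, because all of
        \<open>rs\<close> is eligible.\<close>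
      have "2 * d * q \<le> weight (?E M ys) * \<beta>"
        using Cons.prems(12) g by (auto dest: spec[of _ 0])
      then have "2 * d * q \<le> weight tk * \<beta> + weight rs * \<beta>"
        unfolding filled(1) by (simp add: algebra_simps)
      then have "2 * d * q \<le> 2 * d + weight rs * \<beta>" using filled(4) by linarith
      then have "2 * d * (q - 1) \<le> weight rs * \<beta>" by (simp add: algebra_simps)
      moreover have "2 * d * (q - 1 - g) \<le> 2 * d * (q - 1)" by (intro mult_le_mono2 diff_le_self)
      ultimately show ?thesis unfolding E by (rule le_trans[rotated])
    qed
    \<comment> \<open>For \<open>q = 0\<close> the truncated \<open>q - 1\<close> is again 0: a
      machine filled beyond the guaranteed number merely saves a big job.\<close>
    have "\<exists>b N ys'. b \<le> length Ms - (q - 1) \<and>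
       foldl (serve \<beta> d) (rs, U, rev (map (\<lambda>y. (y, M)) tk) @ A) Ms =
         (ys', drop b U, N @ rev (map (\<lambda>y. (y, M)) tk) @ A) \<and>
       distinct (map fst N) \<and> fst ` set N \<subseteq> set rs \<union> set (take b U) \<and> snd ` set N \<subseteq> set Ms \<and>
       (\<forall>M\<in>set Ms. served \<beta> d N M)"
      by (rule Cons.IH) (use Cons.prems srt dst sub hall' in \<open>auto simp: sorted_append\<close>)
    then obtain b N ys' where b: "b \<le> length Ms - (q - 1)" and
      res: "foldl (serve \<beta> d) (rs, U, rev (map (\<lambda>y. (y, M)) tk) @ A) Ms =
         (ys', drop b U, N @ rev (map (\<lambda>y. (y, M)) tk) @ A)" and
      N: "distinct (map fst N)" "fst ` set N \<subseteq> set rs \<union> set (take b U)" "snd ` set N \<subseteq> set Ms"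
       "\<forall>M\<in>set Ms. served \<beta> d N M"
      by blast
    let ?T = "rev (map (\<lambda>y. (y, M)) tk)"
    have load_tk: "load ?T M = set tk" by (auto simp: load_def)
    have M: "M \<notin> set Ms" using Cons.prems(5) by simp
    have "served \<beta> d (N @ ?T) M"
    proof -
      have "M \<notin> snd ` set N" using N(3) M by blast
      then have "load (N @ ?T) M = set tk" by (simp add: load_append load_tk load_eq_empty)
      then show ?thesis
        using filled(3,5) dst by (simp add: served_def sum_weight distinct_card)
    qed
    moreover have "served \<beta> d (N @ ?T) M'" if "M' \<in> set Ms" for M'
    proof -
      have "load ?T M' = {}" using that M by (auto simp: load_def)
      then show ?thesis using N(4) that by (simp add: served_def load_append)
    qed
    moreover have "set tk \<inter> fst ` set N = {}"
      using N(2) dst Cons.prems(2) sub set_take_subset[of b U] by fastforce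
    then have "distinct (map fst (N @ ?T))"
      using N(1) dst by (simp add: rev_map[symmetric] comp_def Int_commute image_image)
    moreover have "fst ` set (N @ ?T) \<subseteq> set ys \<union> set (take b U)" "snd ` set (N @ ?T) \<subseteq> set (M # Ms)"
      using N(2,3) sub by auto
    moreover have "b \<le> length (M # Ms) - q" using b Cons.prems(10) by auto
    moreover have "foldl (serve \<beta> d) (ys, U, A) (M # Ms) = (ys', drop b U, (N @ ?T) @ A)"
      using filled(2) res by simp
    ultimately show ?thesis
      by (intro exI[of _ b] exI[of _ "N @ ?T"] exI[of _ ys']) auto
  next
    case unfilled
    \<comment> \<open>With \<open>q > 0\<close> the condition at index 0 would give \<open>M\<close>
      eligible jobs of more than the target weight. Hence filling can fail only when the guaranteed
      number is used up, and this bounds the big jobs spent.\<close>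
    have q: "q = 0"
    proof (rule ccontr)
      assume "q \<noteq> 0"
      then have "2 * d * q \<le> weight (?E M ys) * \<beta>"
        using Cons.prems(12) by (auto dest: spec[of _ 0])
      moreover have "d * 1 \<le> d * q" using \<open>q \<noteq> 0\<close> by (intro mult_le_mono2) simp
      ultimately show False using unfilled(1) by simp
    qed
    then obtain u U' where U: "U = u # U'"
      using Cons.prems(11) by (cases U) auto
    have "\<exists>b N ys'. b \<le> length Ms - 0 \<and>
       foldl (serve \<beta> d) (ys, U', (u, M) # A) Ms = (ys', drop b U', N @ (u, M) # A) \<and>
       distinct (map fst N) \<and> fst ` set N \<subseteq> set ys \<union> set (take b U') \<and> snd ` set N \<subseteq> set Ms \<and>
       (\<forall>M\<in>set Ms. served \<beta> d N M)"
      by (rule Cons.IH) (use Cons.prems U q in auto)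
    then obtain b N ys' where b: "b \<le> length Ms" and
      res: "foldl (serve \<beta> d) (ys, U', (u, M) # A) Ms = (ys', drop b U', N @ (u, M) # A)" and
      N: "distinct (map fst N)" "fst ` set N \<subseteq> set ys \<union> set (take b U')" "snd ` set N \<subseteq> set Ms"
       "\<forall>M\<in>set Ms. served \<beta> d N M"
      by auto
    have M: "M \<notin> set Ms" using Cons.prems(5) by simp
    have "load (N @ [(u, M)]) M = {u}"
      using N(3) M by (auto simp: load_def)
    then have "served \<beta> d (N @ [(u, M)]) M"
      using Cons.prems(6,7) U by (simp add: served_def)
    moreover have "served \<beta> d (N @ [(u, M)]) M'" if "M' \<in> set Ms" for M'
    proof -
      have "load [(u, M)] M' = {}" using that M by (auto simp: load_def)
      then show ?thesis using N(4) that by (simp add: served_def load_append)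
    qed
    moreover have "distinct (map fst (N @ [(u, M)]))"
      using N(1,2) Cons.prems(2) U set_take_subset[of b U'] by auto
    moreover have "fst ` set (N @ [(u, M)]) \<subseteq> set ys \<union> set (take (Suc b) U)"
      "snd ` set (N @ [(u, M)]) \<subseteq> set (M # Ms)"
      using N(2,3) U by auto
    moreover have "foldl (serve \<beta> d) (ys, U, A) (M # Ms) = (ys', drop (Suc b) U, (N @ [(u, M)]) @ A)"
      using unfilled(2) res U by simp
    ultimately show ?thesis
      using b q by (intro exI[of _ "Suc b"] exI[of _ "N @ [(u, M)]"] exI[of _ ys']) auto
  qed
qed

section \<open>The loss from splitting the small jobs by residues\<close>

text \<open>Each selected job pays for itself and for the at most \<open>L - 1\<close> jobs since
  the previous selected one, none of which is heavier by sortedness. Unpaid are the jobs after the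
  last selected one; the residue in front of \<open>mx\<close> bounds their number, and
  \<open>o'\<close> is the number of jobs imagined in front of \<open>xs\<close>.\<close>

lemma weight_le_stride:
  assumes "sorted (map snd xs)" "k < L" "\<forall>y\<in>set xs. snd y \<le> mx"
  shows "weight xs \<le> L * weight (nths xs {p. (p + o') mod L = k}) + ((length xs + o' + (L - 1 - k)) mod L) * mx"
  using assms(1,3)
proof (induction xs arbitrary: mx rule: rev_induct)
  case (snoc x xs)
  let ?t = "(length xs + o' + (L - 1 - k)) mod L" and ?W = "weight (nths xs {p. (p + o') mod L = k})"
  \<comment> \<open>Taking the new, heaviest job for \<open>mx\<close> charges each unpaid job at
    most \<open>snd x\<close>, so \<open>x\<close> can pay for all of them once it is
    selected.\<close>
  have IH: "weight xs \<le> L * ?W + ?t * snd x"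
    using snoc.prems by (intro snoc.IH) (auto simp: sorted_append)
  have "snd x \<le> mx" using snoc.prems by simp
  show ?case
  proof (cases "(length xs + o') mod L = k")
    case True
    have "?t < L" using assms(2) by simp
    then have "(?t + 1) * snd x \<le> L * snd x" by (intro mult_right_mono) simp_all
    then have "weight xs + snd x \<le> L * (?W + snd x)"
      using IH by (simp add: algebra_simps)
    then show ?thesis
      using True by (simp add: nths_append add.commute)
  next
    case False
    \<comment> \<open>A count of \<open>L - 1\<close> unpaid positions would put the position of
      \<open>x\<close> into the residue class, so the counter steps on here without wrapping
      around.\<close>
    have "Suc ?t \<noteq> L"
    proof
      assume *: "Suc ?t = L"
      define n where "n = length xs + o'"
      have "n + (L - 1 - k) = L * ((n + (L - 1 - k)) div L) + (L - 1)"
        using * mult_div_mod_eq[of L "n + (L - 1 - k)"] unfolding n_def by linarith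
      then have "n = L * ((n + (L - 1 - k)) div L) + k" using assms(2) by linarith
      then have "n mod L = k" using assms(2) by (metis mod_less mod_mult_self4)
      then show False using False n_def by simp
    qed
    then have t: "(length (xs @ [x]) + o' + (L - 1 - k)) mod L = Suc ?t"
      by (simp add: mod_Suc)
    have "weight xs + snd x \<le> L * ?W + Suc ?t * snd x"
      using IH by simp
    also have "\<dots> \<le> L * ?W + Suc ?t * mx"
      using \<open>snd x \<le> mx\<close> by (intro add_left_mono mult_le_mono2)
    finally show ?thesis
      unfolding t using False by (simp add: nths_append add.commute)
  qed
qed simp

text \<open>An upward closed property cuts a suffix out of a sorted list. Selection by position in
  \<open>xs\<close> is selection in the suffix with positions shifted by the length of the prefix,
  which becomes the offset \<open>o'\<close>.\<close>

lemma weight_filter_le_stride: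
  assumes "sorted (map snd xs)" "k < L" "\<forall>y\<in>set xs. snd y \<le> mx"
    and P: "\<And>y z. P y \<Longrightarrow> snd y \<le> snd z \<Longrightarrow> P z"
  shows "weight (filter P xs) \<le> L * weight (filter P (stride L k xs)) + (L - 1) * mx"
proof -
  define suf where "suf = filter P xs"
  obtain pre where pre: "xs = pre @ suf" "\<forall>y\<in>set pre. \<not> P y"
    using filter_sorted_suffix[where P = P, OF assms(1)] P unfolding suf_def by blast
  have suf: "\<forall>y\<in>set suf. P y" by (simp add: suf_def)
  have "filter P (nths pre A) = []" for A
    using pre(2) set_nths_subset[of pre A] by (auto simp: filter_empty_conv)
  moreover have "filter P (nths suf A) = nths suf A" for A
    using suf set_nths_subset[of suf A] by (auto simp: filter_id_conv)
  ultimately have eq: "filter P (stride L k xs) = nths suf {p. (p + length pre) mod L = k}"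
    unfolding stride_eq_nths pre(1) by (simp add: nths_append)
  have "weight suf \<le> L * weight (nths suf {p. (p + length pre) mod L = k}) +
      ((length suf + length pre + (L - 1 - k)) mod L) * mx"
    using assms by (intro weight_le_stride) (auto simp: suf_def sorted_filter)
  moreover have "((length suf + length pre + (L - 1 - k)) mod L) * mx \<le> (L - 1) * mx"
  proof (rule mult_right_mono)
    have "(length suf + length pre + (L - 1 - k)) mod L < L" using assms(2) by simp
    then show "(length suf + length pre + (L - 1 - k)) mod L \<le> L - 1" by linarith
  qed simp
  ultimately show ?thesis unfolding suf_def[symmetric] eq by linarith
qed

text \<open>At least \<open>card Q - g\<close> machines of \<open>Q\<close> lie outside the first
  \<open>g\<close>, and none of these has more slots than \<open>Ms ! g\<close>. So the heavy half
  of what each receives in the solution is eligible for \<open>Ms ! g\<close>, and disjointness lets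
  these halves be added up before passing to the stride.\<close>

lemma hall_of_solution:
  assumes S: "sorted (map snd S)" "distinct S" "\<forall>y\<in>set S. snd y * (8 * L) < d" and k: "k < L"
    and Ms: "distinct Ms" "sorted_wrt (\<lambda>M M'. slots M' \<le> slots M) Ms"
    and Q: "Q \<subseteq> set Ms" "\<forall>M\<in>Q. 0 < slots M \<and> d \<le> dem M \<and> X M \<subseteq> set S \<and> card (X M) \<le> slots M \<and> dem M \<le> sum snd (X M)"
    and disj: "\<forall>M\<in>Q. \<forall>M'\<in>Q. M \<noteq> M' \<longrightarrow> X M \<inter> X M' = {}"
    and g: "g < card Q"
  shows "2 * d * (card Q - g) \<le> weight (filter (\<lambda>y. d \<le> 2 * slots (Ms ! g) * snd y) (stride L k S)) * (8 * L)"
proof -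
  define f where "f = slots (Ms ! g)"
  let ?P = "\<lambda>y. d \<le> 2 * f * snd y"
  define R where "R = Q - set (take g Ms)"
  have fin: "finite Q" using Q(1) finite_subset by auto
  have "card Q \<le> length Ms" using Q(1) card_mono card_length le_trans by (metis List.finite_set)
  then have g': "g < length Ms" using g by simp
  have "card (set (take g Ms)) \<le> g" by (rule le_trans[OF card_length]) simp
  then have "card Q - g \<le> card Q - card (set (take g Ms))" by (rule diff_le_mono2)
  also have "\<dots> \<le> card R" unfolding R_def by (rule diff_card_le_card_Diff) simp
  finally have cardR: "card Q - g \<le> card R" .
  have slotsR: "slots M \<le> f" if "M \<in> R" for M
  proof -
    have "M \<in> set (drop g Ms)"
      using that Q(1) set_append[of "take g Ms" "drop g Ms"] by (auto simp: R_def)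
    then obtain i where "M = Ms ! (g + i)" "g + i < length Ms"
      by (auto simp: in_set_conv_nth)
    then show ?thesis
      unfolding f_def using Ms(2) sorted_wrt_nth_less[OF Ms(2), of g "g + i"] by (cases i) auto
  qed
  have half: "d \<le> 2 * sum snd {y \<in> X M. ?P y}" if M: "M \<in> R" for M
  proof -
    have MQ: "M \<in> Q" using M by (simp add: R_def)
    have finX: "finite (X M)" using Q(2) MQ by (meson List.finite_set finite_subset)
    have f0: "0 < f" using slotsR[OF M] Q(2) MQ by fastforce
    let ?C = "{y \<in> X M. \<not> ?P y}"
    have "2 * f * sum snd ?C = (\<Sum>y\<in>?C. 2 * f * snd y)" by (rule sum_distrib_left)
    also have "\<dots> \<le> (\<Sum>y\<in>?C. d)" by (rule sum_mono) auto
    also have "\<dots> = card ?C * d" by simp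
    also have "\<dots> \<le> f * d"
    proof (rule mult_right_mono)
      have "card ?C \<le> card (X M)" using finX by (intro card_mono) auto
      then show "card ?C \<le> f" using Q(2) MQ slotsR[OF M] by fastforce
    qed simp
    finally have "2 * sum snd ?C \<le> d" using f0 by (simp add: mult.assoc mult.left_commute[of 2])
    moreover have "sum snd (X M) = sum snd {y \<in> X M. ?P y} + sum snd ?C"
      using finX by (subst sum.union_disjoint[symmetric]) (auto intro: arg_cong[where f = "sum snd"])
    moreover have "d \<le> sum snd (X M)" using Q(2) MQ by (meson le_trans)
    ultimately show ?thesis by linarith
  qed
  have finR: "finite R" using fin by (simp add: R_def)
  have "card R * d = (\<Sum>M\<in>R. d)" by simp
  also have "\<dots> \<le> (\<Sum>M\<in>R. 2 * sum snd {y \<in> X M. ?P y})" by (rule sum_mono) (rule half)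
  also have "\<dots> = 2 * sum snd (\<Union>M\<in>R. {y \<in> X M. ?P y})"
    unfolding sum_distrib_left[symmetric]
  proof (subst sum.UNION_disjoint)
    show "\<forall>M\<in>R. finite {y \<in> X M. ?P y}"
      using Q(2) by (auto simp: R_def intro: finite_subset[OF _ List.finite_set[of S]])
    show "\<forall>M\<in>R. \<forall>M'\<in>R. M \<noteq> M' \<longrightarrow> {y \<in> X M. ?P y} \<inter> {y \<in> X M'. ?P y} = {}"
      using disj unfolding R_def by blast
  qed (simp_all add: finR)
  also have "\<dots> \<le> 2 * sum snd (set (filter ?P S))"
    using Q(2) by (intro mult_le_mono2 sum_mono2) (auto simp: R_def)
  also have "\<dots> = 2 * weight (filter ?P S)"
    using S(2) by (simp only: sum_weight distinct_filter)
  finally have wR: "card R * d \<le> 2 * weight (filter ?P S)" .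
  define mx where "mx = (if S = [] then 0 else snd (last S))"
  have mx: "\<forall>y\<in>set S. snd y \<le> mx"
  proof
    fix y assume "y \<in> set S"
    then obtain S' z where Sz: "S = S' @ [z]" by (metis empty_iff empty_set rev_exhaust)
    then show "snd y \<le> mx" using S(1) \<open>y \<in> set S\<close> by (auto simp: mx_def sorted_append)
  qed
  have "weight (filter ?P S) \<le> L * weight (filter ?P (stride L k S)) + (L - 1) * mx"
    by (rule weight_filter_le_stride[OF S(1) k mx]) (meson le_trans mult_le_mono2)
  moreover have "(L - 1) * mx * 8 \<le> d"
  proof (cases "S = []")
    case False
    then have "mx * (8 * L) < d" using S(3) by (simp add: mx_def)
    moreover have "(L - 1) * mx * 8 \<le> mx * (8 * L)" by (simp add: algebra_simps)
    ultimately show ?thesis by linarith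
  qed (simp add: mx_def)
  \<comment> \<open>Eight times the eligible weight is at least \<open>4 * d\<close> per machine of
    \<open>R\<close>, while the unpaid jobs of the stride cost at most one \<open>d\<close> in all.
    As \<open>card Q - g\<close> is positive, \<open>2 * d\<close> per machine is left.\<close>
  ultimately have "8 * weight (filter ?P S) \<le> weight (filter ?P (stride L k S)) * (8 * L) + d"
    by (simp add: algebra_simps)
  moreover have "(card Q - g) * d \<le> card R * d" using cardR by (rule mult_right_mono) simp
  moreover have "1 * d \<le> (card Q - g) * d" using g by (intro mult_le_mono1) simp
  moreover have "2 * d * (card Q - g) = 2 * ((card Q - g) * d)" by simp
  ultimately show ?thesis using wR unfolding f_def by linarith
qed

text \<open>The injection moves the solution's jobs off the smallest jobs without making any of them lighter.\<close>

lemma exchange: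
  assumes U: "sorted (map snd U)" "distinct U" and B: "B \<subseteq> set U" "b \<le> card B"
  obtains \<phi> where "inj_on \<phi> (- B)" "\<And>y. y \<in> set U - B \<Longrightarrow> \<phi> y \<in> set (drop b U)"
    "\<And>y. y \<notin> set U \<Longrightarrow> \<phi> y = y" "\<And>y. snd y \<le> snd (\<phi> y)"
proof -
  define T where "T = set (take b U)"
  have UT: "set U = T \<union> set (drop b U)" "T \<inter> set (drop b U) = {}"
    using set_append[of "take b U" "drop b U"] U(2) distinct_append[of "take b U" "drop b U"]
    by (simp_all add: T_def)
  have finB: "finite B" using B(1) finite_subset by auto
  have finT: "finite T" by (simp add: T_def)
  have "card T \<le> b" unfolding T_def by (rule le_trans[OF card_length]) simp
  then have "card T \<le> card B" using B(2) by simp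
  \<comment> \<open>\<open>B\<close> holds jobs that the solution has set free. Those of the first
    \<open>b\<close> jobs that are not free can thus be replaced by distinct free jobs behind
    position \<open>b\<close>, which are no lighter by sortedness.\<close>
  then have "card (T - B) \<le> card (B - T)"
    using finB finT by (metis card_le_sym_Diff)
  then obtain h where h: "h ` (T - B) \<subseteq> B - T" "inj_on h (T - B)"
    using card_le_inj[of "T - B" "B - T"] finB finT by auto
  define \<phi> where "\<phi> = (\<lambda>y. if y \<in> T - B then h y else y)"
  have "inj_on \<phi> (- B)"
    using h unfolding inj_on_def \<phi>_def by (auto split: if_splits)
  moreover have "\<phi> y \<in> set (drop b U)" if "y \<in> set U - B" for y
    using that h(1) UT B(1) unfolding \<phi>_def by auto
  moreover have "\<phi> y = y" if "y \<notin> set U" for y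
    using that UT by (auto simp: \<phi>_def)
  moreover have "snd y \<le> snd (\<phi> y)" for y
  proof (cases "y \<in> T - B")
    case True
    then have "h y \<in> set (drop b U)" using h(1) UT B(1) by auto
    moreover have "sorted (map snd (take b U @ drop b U))" using U(1) by simp
    ultimately show ?thesis
      using True unfolding \<phi>_def T_def map_append sorted_append by auto
  qed (auto simp: \<phi>_def)
  ultimately show thesis by (rule that)
qed

section \<open>From one class to the next\<close>

lemma class_of_props:
  assumes "distinct ms"
  shows "set (class_of ms d) = {M \<in> set ms. d \<le> dem M \<and> dem M \<le> 2 * d}" "distinct (class_of ms d)"
    "sorted_wrt (\<lambda>M M'. slots M' \<le> slots M) (class_of ms d)"
proof -
  let ?C = "filter (\<lambda>M. d \<le> dem M \<and> dem M \<le> 2 * d) ms"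
  show "set (class_of ms d) = {M \<in> set ms. d \<le> dem M \<and> dem M \<le> 2 * d}" "distinct (class_of ms d)"
    using assms by (simp_all add: class_of_def)
  show "sorted_wrt (\<lambda>M M'. slots M' \<le> slots M) (class_of ms d)"
    using sorted_isort[of "\<lambda>M. slots M" ?C]
    by (simp add: class_of_def sorted_wrt_rev sorted_map)
qed

abbreviation in_class :: "machine list \<Rightarrow> nat \<Rightarrow> machine set" where
  "in_class ms d \<equiv> {M \<in> set ms. d \<le> dem M \<and> dem M \<le> 2 * d}"

text \<open>The solution is split by whether a machine of the class holds a big job. Those without
  form \<open>Q\<close> and are fed by small jobs alone, so at least \<open>card Q\<close> machines
  can be filled and at most \<open>card B\<close> big jobs are spent. In the last conclusion
  \<open>S1\<close> is undiminished: small jobs already allocated still count as available, since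
  later classes draw on other residues.\<close>

lemma serve_class_step:
  assumes ms: "distinct ms" "\<forall>M\<in>set ms. 0 < slots M"
    and jobs: "sorted (map snd (S @ U))" "distinct (S @ U)" "\<forall>y\<in>set S. snd y * (8 * L) < d"
    and k: "k < L" and d: "0 < d"
    and sat: "satisfiable (in_class ms d \<union> rest) (set (S @ U))" and disj: "in_class ms d \<inter> rest = {}"
  obtains S1 U1 U2 N where "S1 @ U1 = S @ U" "set S \<subseteq> set S1" "\<exists>ws. S1 = S @ ws \<and> U = ws @ U1"
    "serve_class L ms (k, S, U, A) d = (Suc k, S1, U2, N @ A)"
    "\<forall>y\<in>set S1. snd y * (8 * L) < d" "\<exists>b. U2 = drop b U1 \<and> fst ` set N \<subseteq> set (stride L k S1) \<union> set (take b U1)"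
    "distinct (map fst N)" "snd ` set N \<subseteq> in_class ms d" "\<forall>M\<in>in_class ms d. served (8 * L) d N M"
    "satisfiable rest (set (S1 @ U2))"
proof -
  let ?small = "\<lambda>y::job. snd y * (8 * L) < d"
  define ws where "ws = filter ?small U"
  define U1 where "U1 = filter (\<lambda>y. \<not> ?small y) U"
  define S1 where "S1 = S @ ws"
  define Ms where "Ms = class_of ms d"
  note Ms = class_of_props[OF ms(1), of d, folded Ms_def]
  have srtU: "sorted (map snd U)" using jobs(1) by (simp add: sorted_append)
  have U: "U = ws @ U1"
  proof -
    have up: "\<not> ?small z" if "\<not> ?small y" "snd y \<le> snd z" for y z
      using that mult_le_mono1[of "snd y" "snd z" "8 * L"] by linarith
    have "\<exists>pre. U = pre @ U1 \<and> (\<forall>y\<in>set pre. \<not> \<not> ?small y)"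
      unfolding U1_def by (rule filter_sorted_suffix[OF srtU]) (rule up)
    then obtain pre where pre: "U = pre @ U1" "\<forall>y\<in>set pre. ?small y"
      by blast
    have "ws = filter ?small pre @ filter ?small U1" unfolding ws_def by (subst pre(1)) simp
    also have "filter ?small U1 = []" by (simp add: U1_def filter_empty_conv)
    finally show ?thesis using pre by simp
  qed
  have SU: "S1 @ U1 = S @ U" by (simp add: S1_def U)
  have "sorted (map snd (S1 @ U1))" "distinct (S1 @ U1)"
    unfolding SU by (rule jobs)+
  then have S1: "sorted (map snd S1)" "distinct S1" and U1: "sorted (map snd U1)" "distinct U1"
    unfolding map_append sorted_append distinct_append by blast+
  have S1_small: "\<forall>y\<in>set S1. ?small y" using jobs(3) by (auto simp: S1_def ws_def)
  have U1_big: "\<forall>y\<in>set U1. d \<le> snd y * (8 * L)" by (simp add: U1_def not_less)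
  have S1U1: "set S1 \<inter> set U1 = {}" using jobs(2) unfolding SU[symmetric] by simp
  define CR where "CR = in_class ms d \<union> rest"
  obtain X where X1: "\<forall>M\<in>CR. X M \<subseteq> set (S1 @ U1) \<and> card (X M) \<le> slots M \<and> dem M \<le> sum snd (X M)"
    and X2: "\<forall>M\<in>CR. \<forall>M'\<in>CR. M \<noteq> M' \<longrightarrow> X M \<inter> X M' = {}"
    using sat unfolding satisfiable_def SU[symmetric] CR_def[symmetric] by (elim exE conjE)
  have X: "X M \<subseteq> set (S1 @ U1) \<and> card (X M) \<le> slots M \<and> dem M \<le> sum snd (X M)"
    if "M \<in> in_class ms d \<union> rest" for M
    using X1 that unfolding CR_def by (rule bspec)
  have Xdisj: "X M \<inter> X M' = {}"
    if "M \<in> in_class ms d \<union> rest" "M' \<in> in_class ms d \<union> rest" "M \<noteq> M'" for M M'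
    using bspec[OF bspec[OF X2[unfolded CR_def] that(1)] that(2)] that(3) by (rule mp)
  \<comment> \<open>\<open>big\<close> chooses one big job for each machine of \<open>B\<close>.
    These jobs are distinct because the solution is disjoint, and the later machines leave them
    alone: they are the free jobs for \<open>exchange\<close>.\<close>
  define B where "B = {M \<in> set Ms. \<exists>y\<in>X M. d \<le> snd y * (8 * L)}"
  define Q where "Q = set Ms - B"
  have finB: "finite B" by (simp add: B_def)
  have "\<forall>M\<in>B. \<exists>y\<in>X M. d \<le> snd y * (8 * L)" by (simp add: B_def)
  then obtain big where big: "\<And>M. M \<in> B \<Longrightarrow> big M \<in> X M \<and> d \<le> snd (big M) * (8 * L)" by metis
  have BMs: "B \<subseteq> in_class ms d" using Ms(1) by (auto simp: B_def)
  have bigU: "big ` B \<subseteq> set U1"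
  proof
    fix y assume "y \<in> big ` B"
    then obtain M where M: "M \<in> B" "y = big M" by blast
    then have "y \<in> set (S1 @ U1)" "d \<le> snd y * (8 * L)" using big[of M] X[of M] BMs by auto
    then show "y \<in> set U1" using S1_small by fastforce
  qed
  have "inj_on big B"
  proof (rule inj_onI, rule ccontr)
    fix M M' assume "M \<in> B" "M' \<in> B" "big M = big M'" "M \<noteq> M'"
    then show False using Xdisj[of M M'] big[of M] big[of M'] BMs by auto
  qed
  then have card_big: "card (big ` B) = card B" by (rule card_image)
  have cardQ: "card Q = length Ms - card B"
    unfolding Q_def using finB Ms(2) by (simp add: card_Diff_subset B_def distinct_card)
  have cardB: "card B \<le> length Ms"
    using card_mono[of "set Ms" B] card_length[of Ms] by (simp add: B_def)
  have QX: "\<forall>M\<in>Q. 0 < slots M \<and> d \<le> dem M \<and> X M \<subseteq> set S1 \<and> card (X M) \<le> slots M \<and> dem M \<le> sum snd (X M)"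
  proof
    fix M assume M: "M \<in> Q"
    then have MC: "M \<in> in_class ms d" using Ms(1) by (simp add: Q_def)
    have "X M \<inter> set U1 = {}" using M U1_big by (auto simp: Q_def B_def)
    then show "0 < slots M \<and> d \<le> dem M \<and> X M \<subseteq> set S1 \<and> card (X M) \<le> slots M \<and> dem M \<le> sum snd (X M)"
      using X[of M] MC ms(2) by auto
  qed
  have Qdisj: "\<forall>M\<in>Q. \<forall>M'\<in>Q. M \<noteq> M' \<longrightarrow> X M \<inter> X M' = {}"
    using Xdisj Ms(1) by (simp add: Q_def)
  let ?ys = "stride L k S1"
  have ys: "set ?ys \<subseteq> set S1" "distinct ?ys"
    unfolding stride_eq_nths using S1(2) by (simp_all add: set_nths_subset)
  have "\<exists>b N ys'. b \<le> length Ms - card Q \<and> foldl (serve (8 * L) d) (?ys, U1, A) Ms = (ys', drop b U1, N @ A) \<and>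
     distinct (map fst N) \<and> fst ` set N \<subseteq> set ?ys \<union> set (take b U1) \<and> snd ` set N \<subseteq> set Ms \<and>
     (\<forall>M\<in>set Ms. served (8 * L) d N M)"
  proof (rule serve_foldl)
    show "sorted (map snd ?ys)"
      using S1(1) unfolding stride_eq_nths nths_map[symmetric] by (rule sorted_nths)
    show "distinct (?ys @ U1)" using ys S1U1 U1(2) by auto
    show "\<forall>y\<in>set ?ys. snd y * (8 * L) < d" using ys(1) S1_small by blast
    show "\<forall>M\<in>set Ms. 0 < slots M" using Ms(1) ms(2) by simp
    show "8 \<le> 8 * L" using k by simp
    show "card Q \<le> length Ms" by (simp add: cardQ)
    show "length Ms - card Q \<le> length U1"
      using card_mono[OF _ bigU] card_big cardB U1(2) by (simp add: cardQ distinct_card)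
    show "\<forall>g<card Q. 2 * d * (card Q - g) \<le> weight (filter (\<lambda>y. d \<le> 2 * slots (Ms ! g) * snd y) ?ys) * (8 * L)"
      by (intro allI impI hall_of_solution[OF S1 S1_small k Ms(2,3) _ QX Qdisj]) (auto simp: Q_def)
  qed (use Ms U1 U1_big d in auto)
  then obtain b N ys' where b: "b \<le> length Ms - card Q"
    and res: "foldl (serve (8 * L) d) (?ys, U1, A) Ms = (ys', drop b U1, N @ A)"
    and N: "distinct (map fst N)" "fst ` set N \<subseteq> set ?ys \<union> set (take b U1)" "snd ` set N \<subseteq> set Ms"
     "\<forall>M\<in>set Ms. served (8 * L) d N M"
    by blast
  have "b \<le> card (big ` B)" using b cardB by (simp add: card_big cardQ)
  then obtain \<phi> where \<phi>: "inj_on \<phi> (- big ` B)" "\<And>y. y \<in> set U1 - big ` B \<Longrightarrow> \<phi> y \<in> set (drop b U1)"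
    "\<And>y. y \<notin> set U1 \<Longrightarrow> \<phi> y = y" "\<And>y. snd y \<le> snd (\<phi> y)"
    using exchange[OF U1(1,2) bigU] by metis
  \<comment> \<open>The sets of the remaining machines avoid the image of \<open>B\<close> under
    \<open>big\<close>, so \<phi> is injective on them. Their images keep size and disjointness and
    do not lose weight.\<close>
  have "satisfiable rest (set (S1 @ drop b U1))"
    unfolding satisfiable_def
  proof (intro exI[of _ "\<lambda>M. \<phi> ` X M"] conjI ballI impI)
    have avoid: "X M \<subseteq> - big ` B" if "M \<in> rest" for M
    proof
      fix y assume y: "y \<in> X M"
      show "y \<in> - big ` B"
      proof
        assume "y \<in> big ` B"
        then obtain M' where "M' \<in> B" "y = big M'" by blast
        moreover then have "M' \<in> in_class ms d" "M' \<noteq> M" using BMs disj that by auto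
        ultimately show False using Xdisj[of M' M] big[of M'] that y by auto
      qed
    qed
    fix M assume M: "M \<in> rest"
    have finX: "finite (X M)" using X[of M] M by (meson List.finite_set UnI2 finite_subset)
    have inj: "inj_on \<phi> (X M)" using \<phi>(1) avoid[OF M] by (rule inj_on_subset)
    show "\<phi> ` X M \<subseteq> set (S1 @ drop b U1)"
    proof
      fix z assume "z \<in> \<phi> ` X M"
      then obtain y where y: "y \<in> X M" "z = \<phi> y" by blast
      have "y \<in> set (S1 @ U1)" using X[of M] M y by auto
      then show "z \<in> set (S1 @ drop b U1)"
        using \<phi>(2)[of y] \<phi>(3)[of y] avoid[OF M] y by (cases "y \<in> set U1") auto
    qed
    show "card (\<phi> ` X M) \<le> slots M" using X[of M] M card_image[OF inj] by simp
    have "sum snd (X M) \<le> (\<Sum>y\<in>X M. snd (\<phi> y))" by (rule sum_mono) (rule \<phi>(4))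
    also have "\<dots> = sum snd (\<phi> ` X M)" by (simp add: sum.reindex[OF inj])
    finally show "dem M \<le> sum snd (\<phi> ` X M)" using X[of M] M by simp
    fix M' assume M': "M' \<in> rest" "M \<noteq> M'"
    have "\<phi> ` X M \<inter> \<phi> ` X M' = \<phi> ` (X M \<inter> X M')"
      using inj_on_image_Int[OF \<phi>(1) avoid[OF M] avoid[OF M'(1)]] by simp
    then show "\<phi> ` X M \<inter> \<phi> ` X M' = {}" using Xdisj[of M M'] M M' by simp
  qed
  then show thesis
    using SU S1_small N(1)
  proof (intro that[of S1 U1 "drop b U1" N])
    show "serve_class L ms (k, S, U, A) d = (Suc k, S1, drop b U1, N @ A)"
      using res by (simp add: serve_class_def Let_def ws_def[symmetric] U1_def[symmetric] S1_def[symmetric] Ms_def[symmetric])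
    show "\<exists>ws. S1 = S @ ws \<and> U = ws @ U1" using U S1_def by blast
    show "\<exists>ba. drop b U1 = drop ba U1 \<and> fst ` set N \<subseteq> set ?ys \<union> set (take ba U1)" using N(2) by blast
  qed (use SU S1 N Ms(1) in \<open>simp_all add: S1_def\<close>)
qed

text \<open>The inclusion for the allocated jobs makes the induction work: from class
  \<open>k\<close> on, jobs already in \<open>S\<close> are touched only at residues at least
  \<open>k\<close>, at positions that later appends do not change. Jobs that enter the list later
  are still in \<open>U\<close> at this point and need no condition on residues.\<close>

lemma serve_classes:
  assumes ms: "distinct ms" "\<forall>M\<in>set ms. 0 < slots M"
    and "sorted (map snd (S @ U))" "distinct (S @ U)" "\<forall>d\<in>set ds. \<forall>y\<in>set S. snd y * (8 * L) < d"
    and "k + length ds \<le> L" "\<forall>d\<in>set ds. 0 < d" "sorted_wrt (\<lambda>d d'. 2 * d < d') ds"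
    and "satisfiable (\<Union>d\<in>set ds. in_class ms d) (set (S @ U))"
  shows "\<exists>k' S' U' N. foldl (serve_class L ms) (k, S, U, A) ds = (k', S', U', N @ A) \<and> distinct (map fst N) \<and>
     fst ` set N \<subseteq> set U \<union> set (nths S {p. k \<le> p mod L}) \<and> snd ` set N \<subseteq> (\<Union>d\<in>set ds. in_class ms d) \<and>
     (\<forall>d\<in>set ds. \<forall>M\<in>in_class ms d. served (8 * L) d N M)"
  using assms(3-)
proof (induction ds arbitrary: k S U A)
  case Nil
  then show ?case by simp
next
  case (Cons d ds)
  let ?rest = "\<Union>d\<in>set ds. in_class ms d"
  have sep: "\<forall>d'\<in>set ds. 2 * d < d'" using Cons.prems(6) by simp
  have disj: "in_class ms d \<inter> ?rest = {}"
    using sep by fastforce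
  have "k < L" "0 < d" using Cons.prems(4,5) by simp_all
  have sat: "satisfiable (in_class ms d \<union> ?rest) (set (S @ U))"
    using Cons.prems(7) by simp
  have small: "\<forall>y\<in>set S. snd y * (8 * L) < d" using Cons.prems(3) by simp
  obtain S1 U1 U2 N where SU: "S1 @ U1 = S @ U" and "\<exists>ws. S1 = S @ ws \<and> U = ws @ U1"
    and step: "serve_class L ms (k, S, U, A) d = (Suc k, S1, U2, N @ A)"
    and small1: "\<forall>y\<in>set S1. snd y * (8 * L) < d"
    and "\<exists>b. U2 = drop b U1 \<and> fst ` set N \<subseteq> set (stride L k S1) \<union> set (take b U1)"
    and N: "distinct (map fst N)" "snd ` set N \<subseteq> in_class ms d" "\<forall>M\<in>in_class ms d. served (8 * L) d N M"
    and sat1: "satisfiable ?rest (set (S1 @ U2))"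
    by (rule serve_class_step[OF ms Cons.prems(1,2) small \<open>k < L\<close> \<open>0 < d\<close> sat disj]) (rule that)
  then obtain ws b where ws: "S1 = S @ ws" "U = ws @ U1" and U2: "U2 = drop b U1"
    and Nfst: "fst ` set N \<subseteq> set (nths S1 {p. p mod L = k}) \<union> set (take b U1)"
    unfolding stride_eq_nths by blast
  have srt: "sorted (map snd (S1 @ U1))" and dst: "distinct (S1 @ U1)"
    unfolding SU by (rule Cons.prems(1,2))+
  have "sorted (map snd U2)" unfolding U2 drop_map[symmetric]
    using srt by (simp add: sorted_append sorted_wrt_drop)
  moreover have U2sub: "set U2 \<subseteq> set U1" unfolding U2 by (rule set_drop_subset)
  ultimately have "sorted (map snd (S1 @ U2))"
    using srt unfolding map_append sorted_append by fastforce
  moreover have "distinct (S1 @ U2)" using dst U2sub unfolding U2 by auto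
  moreover have "\<forall>d'\<in>set ds. \<forall>y\<in>set S1. snd y * (8 * L) < d'"
    using small1 sep by fastforce
  ultimately obtain k' S' U' N' where
    res: "foldl (serve_class L ms) (Suc k, S1, U2, N @ A) ds = (k', S', U', N' @ N @ A)"
    and N': "distinct (map fst N')" "fst ` set N' \<subseteq> set U2 \<union> set (nths S1 {p. Suc k \<le> p mod L})"
     "snd ` set N' \<subseteq> ?rest" "\<forall>d\<in>set ds. \<forall>M\<in>in_class ms d. served (8 * L) d N' M"
    using Cons.IH[of S1 U2 "Suc k" "N @ A"] Cons.prems(4,5,6) sat1 by auto
  have "set (nths S1 {p. p mod L = k}) \<inter> set (nths S1 {p. Suc k \<le> p mod L}) = {}"
    using dst by (force simp: set_nths nth_eq_iff_index_eq)
  moreover have "set (take b U1) \<inter> set U2 = {}"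
    unfolding U2 using dst by (intro set_take_disj_set_drop_if_distinct) simp_all
  moreover have "set (nths S1 P) \<inter> set U1 = {}" for P
    using dst set_nths_subset[of S1 P] by auto
  ultimately have "fst ` set N' \<inter> fst ` set N = {}"
    using Nfst N'(2) U2sub set_take_subset[of b U1] by blast
  then have "distinct (map fst (N' @ N))" using N(1) N'(1) by simp
  moreover have "fst ` set (N' @ N) \<subseteq> set U \<union> set (nths S {p. k \<le> p mod L})"
  proof -
    have sub: "set (nths S1 P) \<subseteq> set U \<union> set (nths S {p. k \<le> p mod L})" if "P \<subseteq> {p. k \<le> p mod L}" for P
    proof -
      have "set (nths S P) \<subseteq> set (nths S {p. k \<le> p mod L})"
        using that by (auto simp: set_nths)
      moreover have "set (nths ws Q) \<subseteq> set U" for Q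
        using set_nths_subset[of ws Q] ws(2) by auto
      ultimately show ?thesis unfolding ws(1) nths_append by auto
    qed
    have "set (nths S1 {p. p mod L = k}) \<subseteq> set U \<union> set (nths S {p. k \<le> p mod L})"
      "set (nths S1 {p. Suc k \<le> p mod L}) \<subseteq> set U \<union> set (nths S {p. k \<le> p mod L})"
      by (rule sub, force)+
    moreover have "set U1 \<subseteq> set U" unfolding ws(2) by simp
    ultimately show ?thesis
      using Nfst N'(2) U2sub set_take_subset[of b U1] unfolding set_append image_Un by blast
  qed
  moreover have "snd ` set (N' @ N) \<subseteq> (\<Union>d\<in>set (d # ds). in_class ms d)"
    using N(2) N'(3) by auto
  moreover have "served (8 * L) d' (N' @ N) M" if "d' \<in> set (d # ds)" "M \<in> in_class ms d'" for d' M
  proof (cases "M \<in> in_class ms d")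
    case True
    then have "M \<notin> snd ` set N'" using N'(3) disj by blast
    then have "load (N' @ N) M = load N M" by (simp add: load_append load_eq_empty)
    moreover have "d' = d" using that True sep by auto
    moreover have "served (8 * L) d N M" using N(3) True by (rule bspec)
    ultimately show ?thesis by (simp add: served_def)
  next
    case False
    then have "M \<notin> snd ` set N" using N(2) by blast
    then have "load (N' @ N) M = load N' M" by (simp add: load_append load_eq_empty)
    moreover have "d' \<in> set ds" using that False by auto
    moreover have "served (8 * L) d' N' M" using N'(4) calculation(2) that(2) by blast
    ultimately show ?thesis by (simp add: served_def)
  qed
  ultimately show ?case
    using step res by (intro exI[of _ k'] exI[of _ S'] exI[of _ U'] exI[of _ "N' @ N"]) simp
qed

section \<open>The classes and the guarantee for integral instances\<close>

text \<open>The list is processed by increasing demand, so the next demand is never below the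
  current start: it lies within twice that start or opens a class. Starts that more than double make
  the classes disjoint and their number logarithmic.\<close>

lemma class_starts_props:
  shows "sorted_wrt (\<lambda>d d'. 2 * d < d') (class_starts ms)" "set (class_starts ms) \<subseteq> dem ` set ms"
    "M \<in> set ms \<Longrightarrow> \<exists>d\<in>set (class_starts ms). d \<le> dem M \<and> dem M \<le> 2 * d"
proof -
  let ?g = "\<lambda>ds M. if ds = [] then [dem M] else if 2 * hd ds < dem M then dem M # ds else ds"
  have "sorted_wrt (\<lambda>d d'. 2 * d' < d) (foldl ?g [] xs) \<and> set (foldl ?g [] xs) \<subseteq> dem ` set xs \<and>
    (\<forall>M\<in>set xs. \<exists>d\<in>set (foldl ?g [] xs). d \<le> dem M \<and> dem M \<le> 2 * d)"
    if "sorted (map (\<lambda>M. dem M) xs)" for xs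
    using that
  proof (induction xs rule: rev_induct)
    case (snoc M xs)
    define ds where "ds = foldl ?g [] xs"
    have IH: "sorted_wrt (\<lambda>d d'. 2 * d' < d) ds" "set ds \<subseteq> dem ` set xs"
      "\<forall>M\<in>set xs. \<exists>d\<in>set ds. d \<le> dem M \<and> dem M \<le> 2 * d"
      using snoc unfolding ds_def by (simp_all add: sorted_append)
    have le: "\<forall>M'\<in>set xs. dem M' \<le> dem M"
      using snoc.prems by (simp add: sorted_append)
    show ?case
    proof (cases ds)
      case Nil
      then have "xs = []" using IH(3) by (cases xs) auto
      then show ?thesis by simp
    next
      case (Cons d ds')
      have "d \<le> dem M" using IH(2) le Cons by auto
      then show ?thesis
        using IH Cons by (auto simp: ds_def[symmetric])
    qed
  qed simp
  from this[OF sorted_isort[of "\<lambda>M. dem M" ms]]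
  show "sorted_wrt (\<lambda>d d'. 2 * d < d') (class_starts ms)" "set (class_starts ms) \<subseteq> dem ` set ms"
    "M \<in> set ms \<Longrightarrow> \<exists>d\<in>set (class_starts ms). d \<le> dem M \<and> dem M \<le> 2 * d"
    by (simp_all add: class_starts_def sorted_wrt_rev)
qed

lemma sorted_wrt_doubling:
  fixes ds :: "nat list"
  assumes "sorted_wrt (\<lambda>d d'. 2 * d < d') ds" "ds \<noteq> []"
  shows "2 ^ (length ds - 1) * hd ds \<le> last ds"
  using assms
proof (induction ds rule: rev_induct)
  case (snoc d ds)
  show ?case
  proof (cases "ds = []")
    case False
    then have "2 ^ (length ds - 1) * hd ds \<le> last ds" "2 * last ds < d"
      using snoc by (simp_all add: sorted_wrt_append)
    moreover have "(2::nat) ^ length ds = 2 * 2 ^ (length ds - 1)"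
      using False by (cases ds) simp_all
    ultimately show ?thesis using False by simp
  qed simp
qed simp

text \<open>A demand is at most twice the start of its class, which turns the factor
  \<open>8 * L\<close> of \<open>served\<close> into \<open>16 * L\<close>.\<close>

lemma allocate_correct:
  assumes ms: "distinct ms" "\<forall>M\<in>set ms. 0 < slots M" "\<forall>M\<in>set ms. 0 < dem M" and js: "distinct js"
    and sat: "satisfiable (set ms) (set js)"
  defines "A \<equiv> allocate ms js"
  shows "distinct (map fst A)" "fst ` set A \<subseteq> set js" "snd ` set A \<subseteq> set ms"
    "\<And>M. M \<in> set ms \<Longrightarrow> card (load A M) \<le> slots M"
    "\<And>M. M \<in> set ms \<Longrightarrow> dem M \<le> 16 * length (class_starts ms) * sum snd (load A M)"
proof -
  let ?ds = "class_starts ms" and ?U = "isort (\<lambda>y. snd y) js"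
  let ?L = "length ?ds"
  note ds = class_starts_props[where ms = ms]
  have un: "(\<Union>d\<in>set ?ds. in_class ms d) = set ms" using ds(3) by auto
  have "\<exists>k' S' U' N. foldl (serve_class ?L ms) (0, [], ?U, []) ?ds = (k', S', U', N @ []) \<and> distinct (map fst N) \<and>
     fst ` set N \<subseteq> set ?U \<union> set (nths [] {p. 0 \<le> p mod ?L}) \<and> snd ` set N \<subseteq> (\<Union>d\<in>set ?ds. in_class ms d) \<and>
     (\<forall>d\<in>set ?ds. \<forall>M\<in>in_class ms d. served (8 * ?L) d N M)"
  proof (rule serve_classes[OF ms(1,2)])
    show "\<forall>d\<in>set ?ds. 0 < d" using ds(2) ms(3) by auto
    show "satisfiable (\<Union>d\<in>set ?ds. in_class ms d) (set ([] @ ?U))" unfolding un using sat by simp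
    show "sorted (map snd ([] @ ?U))" using sorted_isort[of "\<lambda>y. snd y" js] by simp
  qed (use js ds in auto)
  then obtain N where N: "A = N" "distinct (map fst N)" "fst ` set N \<subseteq> set js" "snd ` set N \<subseteq> set ms"
    "\<forall>d\<in>set ?ds. \<forall>M\<in>in_class ms d. served (8 * ?L) d N M"
    unfolding un A_def allocate_def by auto
  then show "distinct (map fst A)" "fst ` set A \<subseteq> set js" "snd ` set A \<subseteq> set ms" by simp_all
  fix M assume M: "M \<in> set ms"
  then obtain d where d: "d \<in> set ?ds" "d \<le> dem M" "dem M \<le> 2 * d" using ds(3) by blast
  then have "M \<in> in_class ms d" using M by simp
  then have "served (8 * ?L) d A M" using N(1,5) d(1) by blast
  then show "card (load A M) \<le> slots M" "dem M \<le> 16 * ?L * sum snd (load A M)"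
    using d(3) by (simp_all add: served_def mult.commute)
qed

section \<open>Running time\<close>

lemma ptime_fill:
  assumes "ptime b" "ptime d" "ptime M" "ptime ys" "ptime A"
  shows "ptime (\<lambda>x. fill (b x) (d x) (M x) (ys x) (A x))"
proof -
  let ?h = "\<lambda>x. 2 * size_of (ys x) + size_of (M x) + 10"
  let ?g = "\<lambda>x a y. if d x \<le> fst a * b x then (fst a, fst (snd a), snd (snd a) @ [y])
    else (fst a + snd y, (y, M x) # fst (snd a), snd (snd a))"
  have grow: "size_of (?g x a y) \<le> size_of a + ?h x" if "y \<in> set (ys x)" for x y and a :: "nat \<times> allocation \<times> job list"
  proof -
    have "size_of y \<le> size_of (ys x)" using that by (rule size_of_mem)
    moreover have "size_of (fst a + snd y) \<le> size_of (fst a) + size_of y"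
      using floor_log_add_le[of "fst a" "snd y"] by (cases y) simp
    moreover have "Suc (size_of (snd (snd a) @ [y])) = size_of (snd (snd a)) + Suc (Suc (size_of y))"
      by (simp add: size_of_append)
    ultimately show ?thesis by (cases a) auto
  qed
  have "ptime (\<lambda>x. foldl (?g x) (0, A x, []) (ys x))"
  proof (rule ptime_foldl_grow[where h = ?h])
    show "poly_bounded size_of ?h"
      by (intro poly_bounded_intros ptime_size assms)
  qed (assumption | rule grow | intro ptime_basic assms assms[THEN ptime_comp])+
  then show ?thesis unfolding fill_def case_prod_unfold .
qed

lemma size_of_filter_le: "size_of (filter P xs) \<le> size_of xs"
  by (induction xs) auto

lemma size_of_nths_le: "size_of (nths xs I) \<le> size_of xs"
  by (induction xs arbitrary: I) (auto simp: nths_Cons intro: le_SucI trans_le_add2)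

lemma size_of_isort [simp]: "size_of (isort key xs) = size_of xs"
proof -
  have "size_of ys = Suc (\<Sum>y\<in>#mset ys. Suc (size_of y))" for ys :: "'a list"
    by (induction ys) auto
  then show ?thesis by simp
qed

lemma size_of_pairs: "size_of (map (\<lambda>y. (y, M)) ys) \<le> size_of ys * (size_of M + 2)"
  by (induction ys) (auto simp: algebra_simps)

text \<open>Every job handed out is stored with its own copy of \<open>M\<close>, hence the product.
  As the job lists never grow, their initial sizes bound the increment in all later steps as
  well.\<close>

lemma size_of_serve:
  assumes "serve \<beta> d (ys, U, A) M = (ys', U', A')"
  shows "size_of ys' \<le> size_of ys" "size_of U' \<le> size_of U"
    "size_of A' \<le> size_of A + (size_of ys + size_of U + 2) * (size_of M + 2)"
proof -
  define c where "c = (size_of ys + size_of U + 2) * (size_of M + 2)"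
  define zs where "zs = filter (\<lambda>y. d \<le> 2 * slots M * snd y) ys"
  obtain tk rs where tk: "zs = tk @ rs" "fill \<beta> d M zs A = (weight tk, rev (map (\<lambda>y. (y, M)) tk) @ A, rs)"
    using fill_spec by blast
  have "size_of zs \<le> size_of ys" by (simp add: zs_def size_of_filter_le)
  then have "size_of tk + size_of rs \<le> Suc (size_of ys)"
    using size_of_append[of tk rs] tk(1) by simp
  then have sz: "size_of tk \<le> size_of ys" "size_of rs \<le> size_of ys"
    using size_of_pos[of tk] size_of_pos[of rs] by linarith+
  have "size_of (map (\<lambda>y. (y, M)) tk) \<le> size_of ys * (size_of M + 2)"
    using size_of_pairs mult_le_mono1[OF sz(1)] by (rule le_trans)
  then have A1: "size_of (rev (map (\<lambda>y. (y, M)) tk) @ A) \<le> size_of A + c"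
    using size_of_append[of "rev (map (\<lambda>y. (y, M)) tk)" A] by (simp add: c_def algebra_simps)
  have A2: "size_of ((hd U, M) # A) \<le> size_of A + c"
    and tl: "size_of (tl U) \<le> size_of U" if "U \<noteq> []"
    using that by (cases U; simp add: c_def algebra_simps)+
  have eq: "serve \<beta> d (ys, U, A) M = (if d \<le> weight tk * \<beta> then (rs, U, rev (map (\<lambda>y. (y, M)) tk) @ A)
     else if U = [] then (ys, U, A) else (ys, tl U, (hd U, M) # A))"
    using tk(2) unfolding serve_def zs_def by simp
  show "size_of ys' \<le> size_of ys" "size_of U' \<le> size_of U"
    "size_of A' \<le> size_of A + (size_of ys + size_of U + 2) * (size_of M + 2)"
    unfolding c_def[symmetric] using assms A1 A2 tl sz unfolding eq by (auto split: if_splits)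
qed

lemma size_of_foldl_serve:
  assumes "foldl (serve \<beta> d) (ys, U, A) Ms = (ys', U', A')" "size_of ys \<le> a" "size_of U \<le> b"
  shows "size_of ys' \<le> a \<and> size_of U' \<le> b \<and>
    size_of A' \<le> size_of A + length Ms * ((a + b + 2) * (size_of Ms + 2))"
proof -
  have "size_of ys' \<le> a \<and> size_of U' \<le> b \<and> size_of A' \<le> size_of A + length Ms' * ((a + b + 2) * (c + 2))"
    if "foldl (serve \<beta> d) (ys, U, A) Ms' = (ys', U', A')" "size_of ys \<le> a" "size_of U \<le> b" "\<forall>M\<in>set Ms'. size_of M \<le> c"
    for Ms' c
    using that
  proof (induction Ms' arbitrary: ys U A)
    case (Cons M Ms')
    obtain ys1 U1 A1 where s: "serve \<beta> d (ys, U, A) M = (ys1, U1, A1)" by (cases "serve \<beta> d (ys, U, A) M")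
    have "(size_of ys + size_of U + 2) * (size_of M + 2) \<le> (a + b + 2) * (c + 2)"
      using Cons.prems by (intro mult_le_mono) auto
    moreover have "size_of ys' \<le> a \<and> size_of U' \<le> b \<and> size_of A' \<le> size_of A1 + length Ms' * ((a + b + 2) * (c + 2))"
      by (rule Cons.IH[of ys1 U1 A1]) (use Cons.prems s size_of_serve(1,2)[OF s] in auto)
    ultimately show ?case using size_of_serve(3)[OF s] by simp
  qed auto
  from this[OF assms, of "size_of Ms"] size_of_mem show ?thesis by blast
qed

lemma ptime_serve:
  assumes "ptime b" "ptime d" "ptime st" "ptime M"
  shows "ptime (\<lambda>x. serve (b x) (d x) (st x) (M x))"
  unfolding serve_def case_prod_unfold
  by (intro ptime_basic ptime_fill assms assms[THEN ptime_comp])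

lemma ptime_foldl_serve:
  assumes "ptime b" "ptime d" "ptime st" "ptime Ms"
  shows "ptime (\<lambda>x. foldl (serve (b x) (d x)) (st x) (Ms x))"
proof (rule ptime_foldl_bounded)
  let ?a = "\<lambda>x. size_of (fst (st x))" and ?b = "\<lambda>x. size_of (fst (snd (st x)))"
  let ?B = "\<lambda>x. size_of (snd (snd (st x))) + size_of (Ms x) * ((?a x + ?b x + 2) * (size_of (Ms x) + 2)) + ?a x + ?b x + 2"
  show "poly_bounded size_of ?B"
    by (intro poly_bounded_intros ptime_size ptime_basic assms)
  fix x us vs assume eq: "Ms x = us @ vs"
  obtain ys U A where st: "st x = (ys, U, A)" by (cases "st x")
  obtain ys' U' A' where r: "foldl (serve (b x) (d x)) (ys, U, A) us = (ys', U', A')"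
    by (cases "foldl (serve (b x) (d x)) (ys, U, A) us")
  have sz: "size_of us \<le> size_of (Ms x)"
    using size_of_append[of us vs] size_of_pos[of vs] eq by simp
  then have "length us * ((size_of ys + size_of U + 2) * (size_of us + 2))
      \<le> size_of (Ms x) * ((size_of ys + size_of U + 2) * (size_of (Ms x) + 2))"
    using length_le_size_of[of us] by (intro mult_le_mono) auto
  then show "size_of (foldl (serve (b x) (d x)) (st x) us) \<le> ?B x"
    using size_of_foldl_serve[OF r order_refl order_refl] unfolding st r by auto
qed (intro ptime_basic ptime_serve assms assms[THEN ptime_comp])+

lemma ptime_class_of:
  assumes "ptime ms" "ptime d"
  shows "ptime (\<lambda>x. class_of (ms x) (d x))"
  unfolding class_of_def
  by (intro ptime_basic ptime_isort assms assms[THEN ptime_comp])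

lemma ptime_serve_class:
  assumes "ptime L" "ptime ms" "ptime st" "ptime d"
  shows "ptime (\<lambda>x. serve_class (L x) (ms x) (st x) (d x))"
  unfolding serve_class_def case_prod_unfold Let_def
  by (intro ptime_basic ptime_foldl_serve ptime_class_of ptime_stride assms assms[THEN ptime_comp])

lemma size_of_serve_class:
  assumes "serve_class L ms (k, S, U, A) d = (k', S', U', A')" "size_of S + size_of U \<le> a"
  shows "size_of S' + size_of U' \<le> a" "size_of k' \<le> Suc (size_of k)"
    "size_of A' \<le> size_of A + size_of ms * ((2 * a + 2) * (size_of ms + 2))"
proof -
  define S1 where "S1 = S @ filter (\<lambda>y. snd y * (8 * L) < d) U"
  define U1 where "U1 = filter (\<lambda>y. \<not> snd y * (8 * L) < d) U"
  define Ms where "Ms = class_of ms d"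
  have eq: "(Suc k, S1, snd (foldl (serve (8 * L) d) (stride L k S1, U1, A) Ms)) = (k', S', U', A')"
    using assms(1) unfolding serve_class_def Let_def prod.case S1_def U1_def Ms_def .
  then have k: "k' = Suc k" and S': "S' = S1" by simp_all
  obtain ys' where r: "foldl (serve (8 * L) d) (stride L k S1, U1, A) Ms = (ys', U', A')"
    using eq by (cases "foldl (serve (8 * L) d) (stride L k S1, U1, A) Ms") simp
  have "size_of (filter (\<lambda>y. snd y * (8 * L) < d) U) + size_of U1 = Suc (size_of U)"
    unfolding U1_def by (induction U) auto
  then have SU: "size_of S1 + size_of U1 = size_of S + size_of U"
    using size_of_append[of S "filter (\<lambda>y. snd y * (8 * L) < d) U"] unfolding S1_def by simp
  have "size_of (stride L k S1) \<le> a"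
    using size_of_nths_le[of S1 "{p. p mod L = k}"] SU assms(2) unfolding stride_eq_nths by linarith
  moreover have "size_of U1 \<le> size_of U1" ..
  ultimately have res: "size_of U' \<le> size_of U1" "size_of A' \<le> size_of A + length Ms * ((a + size_of U1 + 2) * (size_of Ms + 2))"
    using size_of_foldl_serve[OF r] by blast+
  have "size_of Ms \<le> size_of ms" by (simp add: Ms_def class_of_def size_of_filter_le)
  then have "length Ms * ((a + size_of U1 + 2) * (size_of Ms + 2)) \<le> size_of ms * ((2 * a + 2) * (size_of ms + 2))"
    using length_le_size_of[of Ms] SU assms(2) by (intro mult_le_mono) auto
  then show "size_of A' \<le> size_of A + size_of ms * ((2 * a + 2) * (size_of ms + 2))"
    using res(2) by linarith
  show "size_of S' + size_of U' \<le> a" unfolding S' using res(1) SU assms(2) by linarith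
  show "size_of k' \<le> Suc (size_of k)" unfolding k by (rule size_of_Suc_le)
qed

text \<open>Jobs only move from \<open>U\<close> to \<open>S\<close> or leave \<open>U\<close>, so
  the invariant bounds these two lists together; the counter and the allocation form the part that
  grows per step. The \<open>Suc\<close> in \<open>?a\<close> is the size of the empty
  \<open>S\<close>.\<close>

lemma ptime_foldl_serve_class:
  assumes "ptime L" "ptime ms" "ptime js" "ptime ds"
  shows "ptime (\<lambda>x. foldl (serve_class (L x) (ms x)) (0, [], js x, []) (ds x))"
proof (rule ptime_foldl)
  let ?a = "\<lambda>x. Suc (size_of (js x))"
  let ?Inv = "\<lambda>x (k :: nat, S :: job list, U :: job list, A :: allocation). size_of S + size_of U \<le> ?a x"
  let ?m = "\<lambda>x (k :: nat, S :: job list, U :: job list, A :: allocation). size_of k + size_of A"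
  let ?h = "\<lambda>x. Suc (size_of (ms x) * ((2 * ?a x + 2) * (size_of (ms x) + 2)))"
  show "?Inv x (0, [], js x, [])" for x by simp
  show "?Inv x (serve_class (L x) (ms x) st d)" if "?Inv x st" for x st d
  proof -
    obtain k S U A k' S' U' A' where "st = (k, S, U, A)" "serve_class (L x) (ms x) st d = (k', S', U', A')"
      by (metis prod_cases4)
    then show ?thesis using size_of_serve_class(1)[of "L x" "ms x" k S U A d k' S' U' A'] that by simp
  qed
  show "size_of st \<le> (?a x + 3) + ?m x st" if "?Inv x st" for x st
    using that by (cases st) auto
  show "?m x (serve_class (L x) (ms x) st d) \<le> ?m x st + ?h x" if "?Inv x st" for x st d
  proof -
    obtain k S U A k' S' U' A' where "st = (k, S, U, A)" "serve_class (L x) (ms x) st d = (k', S', U', A')"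
      by (metis prod_cases4)
    then show ?thesis using size_of_serve_class(2,3)[of "L x" "ms x" k S U A d k' S' U' A' "?a x"] that by simp
  qed
  show "poly_bounded size_of (\<lambda>x. ?a x + 3)" "poly_bounded size_of ?h"
    "poly_bounded size_of (\<lambda>x. ?m x (0, [], js x, []))"
    by (auto intro!: poly_bounded_intros poly_bounded_Suc ptime_size assms)
qed (intro ptime_basic ptime_serve_class assms assms[THEN ptime_comp])+

lemma ptime_class_starts:
  assumes "ptime ms"
  shows "ptime (\<lambda>x. class_starts (ms x))"
proof -
  let ?g = "\<lambda>ds (M::machine). if ds = [] then [dem M] else if 2 * hd ds < dem M then dem M # ds else ds"
  have grow: "size_of (?g ds M) \<le> size_of ds + Suc (size_of (isort (\<lambda>M. dem M) (ms x)))"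
    if "M \<in> set (isort (\<lambda>M. dem M) (ms x))" for ds M x
    using size_of_mem[OF that] by (cases M) auto
  show ?thesis
    unfolding class_starts_def
    by (intro ptime_rev ptime_foldl_grow[where h = "\<lambda>x. Suc (size_of (isort (\<lambda>M. dem M) (ms x)))", OF _ _ _ grow])
      (assumption | intro ptime_basic ptime_isort poly_bounded_Suc ptime_size assms)+
qed

lemma ptime_allocate:
  assumes "ptime ms" "ptime js"
  shows "ptime (\<lambda>x. allocate (ms x) (js x))"
  unfolding allocate_def
  by (intro ptime_basic ptime_foldl_serve_class ptime_class_starts ptime_isort assms)

section \<open>Rational instances\<close>

definition numer :: "rat \<Rightarrow> nat" where "numer r = nat (fst (quotient_of r))"
definition denom :: "rat \<Rightarrow> nat" where "denom r = nat (snd (quotient_of r))"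

text \<open>The division is exact for a nonnegative \<open>r\<close> whose denominator divides
  \<open>P\<close>; otherwise the result is rounded down to stay total.\<close>

definition scale :: "nat \<Rightarrow> rat \<Rightarrow> nat" where
  "scale P r = numer r * P div denom r"

text \<open>The product of all denominators in place of their least common multiple: each factor
  adds at most its own length, so the size stays polynomial without computing a gcd.\<close>

definition common_denom :: "rat list \<Rightarrow> nat" where
  "common_denom rs = foldl (\<lambda>p r. p * denom r) 1 rs"

definition scaled_machines :: "nat \<Rightarrow> (rat \<times> nat) list \<Rightarrow> machine list" where
  "scaled_machines P ms = map (\<lambda>e. (fst e, scale P (fst (snd e)), snd (snd e))) (List.enumerate 0 ms)"

definition scaled_jobs :: "nat \<Rightarrow> rat list \<Rightarrow> job list" where
  "scaled_jobs P js = map (\<lambda>e. (fst e, scale P (snd e))) (List.enumerate 0 js)"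

text \<open>0 stands for an unassigned job and \<open>Suc i\<close> for machine \<open>i\<close>,
  the code that \<open>encode_assignment\<close> uses, so \<open>solve\<close> can return these
  numbers directly.\<close>

definition machine_of :: "allocation \<Rightarrow> nat \<Rightarrow> nat" where
  "machine_of A j = foldl (\<lambda>r e. if fst (fst e) = j then Suc (fst (snd e)) else r) 0 A"

definition solve :: "(rat \<times> nat) list \<times> rat list \<Rightarrow> nat list" where
  "solve I = (let P = common_denom (map fst (fst I) @ snd I);
      A = allocate (scaled_machines P (fst I)) (scaled_jobs P (snd I))
    in map (\<lambda>y. machine_of A (fst y)) (List.enumerate 0 (snd I)))"

lemma ptime_numer: "ptime f \<Longrightarrow> ptime (\<lambda>x. numer (f x))"
  by (rule ptime_comp[OF ptime_exp[where e = "Left (Var 0)" and c = 2]])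
    (auto simp: enc_nat_def enc_rat_def encode_rat_def numer_def case_prod_unfold)

lemma ptime_denom: "ptime f \<Longrightarrow> ptime (\<lambda>x. denom (f x))"
  by (rule ptime_comp[OF ptime_exp[where e = "Right (Var 0)" and c = 2]])
    (auto simp: enc_nat_def enc_rat_def encode_rat_def denom_def case_prod_unfold)

lemma size_of_denom: "size_of (denom r) \<le> size_of r"
  by (simp add: enc_nat_def enc_rat_def encode_rat_def denom_def case_prod_unfold)

lemma ptime_scale: "ptime P \<Longrightarrow> ptime r \<Longrightarrow> ptime (\<lambda>x. scale (P x) (r x))"
  unfolding scale_def by (intro ptime_basic ptime_numer ptime_denom)

lemma ptime_common_denom:
  assumes "ptime rs"
  shows "ptime (\<lambda>x. common_denom (rs x))"
  unfolding common_denom_def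
proof (rule ptime_foldl_grow[where h = "\<lambda>x. size_of (rs x)"])
  fix x p r assume "r \<in> set (rs x)"
  then have "size_of (denom r) \<le> size_of (rs x)"
    using size_of_denom size_of_mem le_trans by blast
  then show "size_of (p * denom r) \<le> size_of p + size_of (rs x)"
    using floor_log_mult_le[of p "denom r"] by simp
qed (intro ptime_basic ptime_denom ptime_size assms)+

lemma ptime_machine_of:
  assumes "ptime A" "ptime j"
  shows "ptime (\<lambda>x. machine_of (A x) (j x))"
  unfolding machine_of_def
proof (rule ptime_foldl_grow[where h = "\<lambda>x. Suc (size_of (A x))"])
  fix x r e assume "e \<in> set (A x)"
  then have "size_of e \<le> size_of (A x)" by (rule size_of_mem)
  then show "size_of (if fst (fst e) = j x then Suc (fst (snd e)) else r) \<le> size_of r + Suc (size_of (A x))"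
    using size_of_Suc_le[of "fst (snd e)"] by (cases e; cases "snd e") auto
qed (intro ptime_basic poly_bounded_Suc ptime_size assms assms[THEN ptime_comp])+

lemma ptime_solve: "ptime solve"
proof -
  have "ptime (\<lambda>I. solve I)"
    unfolding solve_def Let_def scaled_machines_def scaled_jobs_def
    by (intro ptime_basic ptime_machine_of ptime_allocate ptime_enumerate ptime_scale ptime_common_denom)
  then show ?thesis .
qed

section \<open>Decoding the allocation and scaling back\<close>

lemma machine_of_eq_Suc:
  assumes "distinct (map (\<lambda>e. fst (fst e)) A)"
  shows "machine_of A j = Suc i \<longleftrightarrow> (\<exists>e\<in>set A. fst (fst e) = j \<and> fst (snd e) = i)"
  using assms
proof (induction A rule: rev_induct)
  case (snoc e A)
  have "machine_of (A @ [e]) j = (if fst (fst e) = j then Suc (fst (snd e)) else machine_of A j)"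
    by (simp add: machine_of_def)
  then show ?case using snoc by (auto simp: image_iff)
qed (simp add: machine_of_def)

lemma denom_pos: "0 < denom r"
  using quotient_of_denom_pos'[of r] by (simp add: denom_def)

lemma common_denom_pos: "0 < common_denom rs"
proof -
  have "0 < p \<Longrightarrow> 0 < foldl (\<lambda>p r. p * denom r) p rs" for p
    by (induction rs arbitrary: p) (simp_all add: denom_pos)
  then show ?thesis by (simp add: common_denom_def)
qed

lemma denom_dvd_common_denom: "r \<in> set rs \<Longrightarrow> denom r dvd common_denom rs"
proof -
  have *: "p dvd foldl (\<lambda>p r. p * denom r) p rs" for p rs
    by (induction rs arbitrary: p) (auto intro: dvd_trans[OF dvd_triv_left])
  have "r \<in> set rs \<Longrightarrow> denom r dvd foldl (\<lambda>p r. p * denom r) p rs" for p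
  proof (induction rs arbitrary: p)
    case (Cons r' rs)
    then show ?case
      using dvd_trans[OF dvd_triv_right *] by (cases "r = r'") auto
  qed simp
  then show "r \<in> set rs \<Longrightarrow> denom r dvd common_denom rs" by (simp add: common_denom_def)
qed

lemma of_nat_scale:
  assumes "0 \<le> r" "denom r dvd P"
  shows "of_nat (scale P r) = r * of_nat P"
proof -
  obtain a b where q: "quotient_of r = (a, b)" by (cases "quotient_of r")
  have b: "0 < b" using quotient_of_denom_pos[OF q] .
  have r: "r = of_int a / of_int b" using quotient_of_div[OF q] .
  have a: "0 \<le> a" using assms(1) b unfolding r by (simp add: zero_le_divide_iff)
  obtain c where c: "P = nat b * c" using assms(2) unfolding dvd_def denom_def q by auto
  have "scale P r = nat a * c" using b unfolding scale_def numer_def denom_def q c by simp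
  then show ?thesis using a b unfolding r c by simp
qed

lemma scaled_machines_eq:
  "scaled_machines P ms = map (\<lambda>i. (i, scale P (fst (ms ! i)), snd (ms ! i))) [0..<length ms]"
  by (rule nth_equalityI) (simp_all add: scaled_machines_def nth_enumerate_eq)

lemma scaled_jobs_eq: "scaled_jobs P js = map (\<lambda>j. (j, scale P (js ! j))) [0..<length js]"
  by (rule nth_equalityI) (simp_all add: scaled_jobs_def nth_enumerate_eq)

lemma encode_list_map: "encode_list g (map f xs) = encode_list (\<lambda>x. g (f x)) xs"
  by (induction xs) auto

lemma solve_correct:
  assumes I: "valid_instance I" and \<sigma>: "feasible I \<sigma>"
  shows "\<exists>\<sigma>'. encode_assignment \<sigma>' = enc (solve (machines I, jobs I)) \<and>
    approximately_feasible (16 * (1 + log 2 (real_of_rat (demand_ratio I)))) I \<sigma>'"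
proof -
  let ?m = "num_machines I" and ?n = "num_jobs I"
  define P where "P = common_denom (map fst (machines I) @ jobs I)"
  define mach where "mach i = (i, scale P (demand I i), cardinality_bound I i)" for i
  define job where "job j = (j, scale P (capacity I j))" for j
  define ms where "ms = map mach [0..<?m]"
  define js where "js = map job [0..<?n]"
  have P: "0 < P" unfolding P_def by (rule common_denom_pos)
  have dem: "of_nat (dem (mach i)) = demand I i * of_nat P" "0 < demand I i" "1 \<le> cardinality_bound I i"
    if "i < ?m" for i
    using that I unfolding mach_def P_def valid_instance_def
    by (auto simp: demand_def intro!: of_nat_scale denom_dvd_common_denom less_imp_le)
  have cap: "of_nat (snd (job j)) = capacity I j * of_nat P" "0 < capacity I j" if "j < ?n" for j
    using that I unfolding job_def P_def valid_instance_def
    by (auto simp: capacity_def intro!: of_nat_scale denom_dvd_common_denom less_imp_le)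
  have inj_mach: "inj_on mach X" and inj_job: "inj_on job X" for X
    by (auto simp: inj_on_def mach_def job_def)
  have dst: "distinct ms" "distinct js"
    using inj_mach inj_job by (simp_all add: ms_def js_def distinct_map)
  have slots: "\<forall>M\<in>set ms. 0 < slots M"
    using dem(3) by (auto simp: ms_def mach_def Suc_le_eq)
  have dem_pos: "\<forall>M\<in>set ms. 0 < dem M"
  proof
    fix M assume "M \<in> set ms"
    then obtain i where i: "i < ?m" "M = mach i" by (auto simp: ms_def)
    have "0 < demand I i * of_nat P" using dem(2)[OF i(1)] P by simp
    then have "(0::rat) < of_nat (dem M)" unfolding i(2) dem(1)[OF i(1)] .
    then show "0 < dem M" by simp
  qed
  have sat: "satisfiable (set ms) (set js)"
    unfolding satisfiable_def
  proof (intro exI[of _ "\<lambda>M. job ` jobs_on I \<sigma> (fst M)"] conjI ballI impI)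
    fix M assume "M \<in> set ms"
    then obtain i where i: "i < ?m" "M = mach i" by (auto simp: ms_def)
    then have fst: "fst M = i" by (simp add: mach_def)
    show "job ` jobs_on I \<sigma> (fst M) \<subseteq> set js" by (auto simp: jobs_on_def js_def)
    show "card (job ` jobs_on I \<sigma> (fst M)) \<le> slots M"
      using \<sigma> i unfolding card_image[OF inj_job] feasible_def respects_cardinalities_def by (simp add: mach_def)
    have "of_nat (dem M) \<le> received I \<sigma> i * of_nat P"
      unfolding i(2) dem(1)[OF i(1)] using \<sigma> i(1) P by (simp add: feasible_def)
    also have "\<dots> = (\<Sum>j\<in>jobs_on I \<sigma> i. of_nat (snd (job j)))"
      unfolding received_def sum_distrib_right by (rule sum.cong) (auto simp: cap jobs_on_def)
    also have "\<dots> = of_nat (sum snd (job ` jobs_on I \<sigma> (fst M)))"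
      by (simp add: sum.reindex[OF inj_job] fst)
    finally show "dem M \<le> sum snd (job ` jobs_on I \<sigma> (fst M))"
      by (simp only: of_nat_le_iff)
    fix M' assume "M' \<in> set ms" "M \<noteq> M'"
    then have "fst M' \<noteq> i" using i by (auto simp: ms_def mach_def)
    then show "job ` jobs_on I \<sigma> (fst M) \<inter> job ` jobs_on I \<sigma> (fst M') = {}"
      unfolding fst by (auto simp: jobs_on_def job_def)
  qed
  define A where "A = allocate ms js"
  note A = allocate_correct[OF dst(1) slots dem_pos dst(2) sat, folded A_def]
  \<comment> \<open>Jobs are determined by their positions. Distinct jobs in the allocation
    therefore have distinct positions, and \<open>machine_of\<close> has at most one match.\<close>
  have "inj_on fst (set js)" by (auto simp: inj_on_def js_def job_def)
  then have "inj_on fst (fst ` set A)" using A(2) inj_on_subset by blast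
  then have "distinct (map fst (map fst A))" using A(1) by (simp only: distinct_map set_map)
  then have machine_of: "machine_of A j = Suc i \<longleftrightarrow> (\<exists>e\<in>set A. fst (fst e) = j \<and> fst (snd e) = i)" for i j
    by (intro machine_of_eq_Suc) (simp add: comp_def)
  define \<sigma>' where "\<sigma>' = map (\<lambda>j. case machine_of A j of 0 \<Rightarrow> None | Suc i \<Rightarrow> Some i) [0..<?n]"
  have \<sigma>'_nth: "\<sigma>' ! j = Some i \<longleftrightarrow> machine_of A j = Suc i" if "j < ?n" for i j
    using that by (simp add: \<sigma>'_def split: nat.split)
  have in_A: "\<exists>j<?n. \<exists>i<?m. e = (job j, mach i)" if "e \<in> set A" for e
    using A(2,3) that by (cases e) (force simp: ms_def js_def)
  have load: "load A (mach i) = job ` jobs_on I \<sigma>' i" if i: "i < ?m" for i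
  proof (intro equalityI subsetI)
    fix y assume "y \<in> load A (mach i)"
    then have y: "(y, mach i) \<in> set A" by (simp add: load_def)
    then obtain j where "j < ?n" "y = job j" using in_A by blast
    moreover then have "machine_of A j = Suc i"
      unfolding machine_of using y by (intro bexI[of _ "(y, mach i)"]) (auto simp: job_def mach_def)
    ultimately show "y \<in> job ` jobs_on I \<sigma>' i" by (simp add: jobs_on_def \<sigma>'_nth)
  next
    fix y assume "y \<in> job ` jobs_on I \<sigma>' i"
    then obtain j where j: "j < ?n" "y = job j" "machine_of A j = Suc i"
      by (auto simp: jobs_on_def \<sigma>'_nth)
    then obtain e where e: "e \<in> set A" "fst (fst e) = j" "fst (snd e) = i" unfolding machine_of by blast
    then have "e = (job j, mach i)" using in_A[OF e(1)] by (auto simp: job_def mach_def)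
    then show "y \<in> load A (mach i)" using e(1) j(2) by (simp add: load_def)
  qed
  have mach_in: "mach i \<in> set ms" if "i < ?m" for i using that by (simp add: ms_def)
  let ?L = "length (class_starts ms)" and ?\<alpha> = "16 * (1 + log 2 (real_of_rat (demand_ratio I)))"
  \<comment> \<open>The first and the last start are demands of machines of the instance, and their
    ratio is at least \<open>2 ^ (L - 1)\<close>; the scaling factor \<open>P\<close> cancels. The
    summand 1 counts the first class, which exists even when all demands are equal.\<close>
  have L: "real ?L \<le> 1 + log 2 (real_of_rat (demand_ratio I))" and L1: "1 \<le> ?L"
  proof -
    have m: "0 < ?m" using I unfolding valid_instance_def by linarith
    let ?D = "demand I ` {..<?m}" and ?ds = "class_starts ms"
    have ne: "?ds \<noteq> []" using class_starts_props(3)[OF mach_in[OF m]] by auto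
    then show "1 \<le> ?L" by (simp add: Suc_le_eq)
    have "hd ?ds \<in> dem ` set ms" "last ?ds \<in> dem ` set ms"
      using class_starts_props(2)[of ms] ne by auto
    then obtain i i' where i: "i < ?m" "hd ?ds = dem (mach i)" and i': "i' < ?m" "last ?ds = dem (mach i')"
      by (auto simp: ms_def)
    have "2 ^ (?L - 1) * dem (mach i) \<le> dem (mach i')"
      using sorted_wrt_doubling[OF class_starts_props(1) ne] i(2) i'(2) by simp
    then have "(of_nat (2 ^ (?L - 1) * dem (mach i)) :: rat) \<le> of_nat (dem (mach i'))"
      by (simp only: of_nat_le_iff)
    then have "2 ^ (?L - 1) * demand I i * of_nat P \<le> demand I i' * of_nat P"
      unfolding of_nat_mult dem(1)[OF i(1)] dem(1)[OF i'(1)] by (simp add: mult.assoc)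
    then have "2 ^ (?L - 1) * demand I i \<le> demand I i'" using P by simp
    also have "\<dots> \<le> Max ?D" using i'(1) by simp
    finally have "2 ^ (?L - 1) * demand I i \<le> Max ?D" .
    moreover have "2 ^ (?L - 1) * Min ?D \<le> 2 ^ (?L - 1) * demand I i" using i(1) by simp
    ultimately have "2 ^ (?L - 1) * Min ?D \<le> Max ?D" by linarith
    moreover have "0 < Min ?D" using m dem(2) by (subst Min_gr_iff) auto
    ultimately have "2 ^ (?L - 1) \<le> demand_ratio I"
      by (simp add: demand_ratio_def pos_le_divide_eq)
    then have "real_of_rat (2 ^ (?L - 1)) \<le> real_of_rat (demand_ratio I)"
      by (simp only: of_rat_less_eq)
    then have "real (?L - 1) \<le> log 2 (real_of_rat (demand_ratio I))"
      by (intro le_log_of_power) (simp_all add: of_rat_power)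
    then show "real ?L \<le> 1 + log 2 (real_of_rat (demand_ratio I))" by linarith
  qed
  have "approximately_feasible ?\<alpha> I \<sigma>'"
    unfolding approximately_feasible_def
  proof (intro conjI allI impI)
    have "i < ?m" if i: "Some i \<in> set \<sigma>'" for i
    proof -
      obtain j where "j < length \<sigma>'" "\<sigma>' ! j = Some i" using i by (auto simp: in_set_conv_nth)
      then have "machine_of A j = Suc i" using \<sigma>'_nth[of j i] by (simp add: \<sigma>'_def)
      then obtain e where "e \<in> set A" "fst (snd e) = i" unfolding machine_of by blast
      then show ?thesis using in_A[of e] by (auto simp: mach_def)
    qed
    then show "is_assignment I \<sigma>'" by (simp add: is_assignment_def \<sigma>'_def)
    show "respects_cardinalities I \<sigma>'"
      unfolding respects_cardinalities_def
    proof (intro allI impI)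
      fix i assume i: "i < ?m"
      have "card (jobs_on I \<sigma>' i) = card (load A (mach i))" unfolding load[OF i] card_image[OF inj_job] ..
      also have "\<dots> \<le> slots (mach i)" by (rule A(4)[OF mach_in[OF i]])
      finally show "card (jobs_on I \<sigma>' i) \<le> cardinality_bound I i" by (simp add: mach_def)
    qed
    fix i assume i: "i < ?m"
    have "of_nat (sum snd (load A (mach i))) = (\<Sum>j\<in>jobs_on I \<sigma>' i. (of_nat (snd (job j)) :: rat))"
      unfolding load[OF i] by (simp add: sum.reindex[OF inj_job])
    also have "\<dots> = received I \<sigma>' i * of_nat P"
      unfolding received_def sum_distrib_right by (rule sum.cong) (auto simp: cap jobs_on_def)
    finally have rec: "of_nat (sum snd (load A (mach i))) = received I \<sigma>' i * of_nat P" .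
    have "(of_nat (dem (mach i)) :: rat) \<le> of_nat (16 * ?L * sum snd (load A (mach i)))"
      using A(5)[OF mach_in[OF i]] by (simp only: of_nat_le_iff)
    then have "demand I i * of_nat P \<le> 16 * of_nat ?L * received I \<sigma>' i * of_nat P"
      unfolding dem(1)[OF i] of_nat_mult rec by (simp add: mult.assoc)
    then have "demand I i \<le> 16 * of_nat ?L * received I \<sigma>' i" using P by simp
    then have "real_of_rat (demand I i) \<le> real_of_rat (16 * of_nat ?L * received I \<sigma>' i)"
      by (simp only: of_rat_less_eq)
    then have 1: "real_of_rat (demand I i) \<le> 16 * real ?L * real_of_rat (received I \<sigma>' i)"
      by (simp add: of_rat_mult)
    have "0 \<le> received I \<sigma>' i"
      unfolding received_def by (rule sum_nonneg) (auto simp: jobs_on_def intro: less_imp_le cap)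
    then have "16 * real ?L * real_of_rat (received I \<sigma>' i) \<le> ?\<alpha> * real_of_rat (received I \<sigma>' i)"
      using L by (intro mult_right_mono) simp_all
    moreover have "0 < real ?L" using L1 by (simp only: of_nat_0_less_iff)
    then have "0 < 1 + log 2 (real_of_rat (demand_ratio I))" using L by (rule less_le_trans)
    then have "0 < ?\<alpha>" by (intro mult_pos_pos) simp_all
    ultimately show "real_of_rat (demand I i) / ?\<alpha> \<le> real_of_rat (received I \<sigma>' i)"
      using 1 by (simp add: divide_le_eq mult.commute)
  qed
  moreover have "encode_assignment \<sigma>' = enc (solve (machines I, jobs I))"
  proof -
    have "scaled_machines P (machines I) = ms"
      by (simp add: scaled_machines_eq ms_def mach_def demand_def cardinality_bound_def)
    moreover have "scaled_jobs P (jobs I) = js"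
      by (simp add: scaled_jobs_eq js_def job_def capacity_def)
    ultimately have "solve (machines I, jobs I) = map (machine_of A) (map fst (List.enumerate 0 (jobs I)))"
      by (simp add: solve_def Let_def P_def[symmetric] A_def comp_def del: map_fst_enumerate)
    also have "\<dots> = map (machine_of A) [0..<?n]" by simp
    finally have "solve (machines I, jobs I) = map (machine_of A) [0..<?n]" .
    moreover have "(\<lambda>j. case (case machine_of A j of 0 \<Rightarrow> None | Suc i \<Rightarrow> Some i) of None \<Rightarrow> Num 0 | Some i \<Rightarrow> Num (Suc i)) =
        (\<lambda>j. enc (machine_of A j))"
      by (auto simp: enc_nat_def fun_eq_iff split: nat.split)
    ultimately show ?thesis
      by (simp add: encode_assignment_def \<sigma>'_def enc_list_def encode_list_map)
  qed
  ultimately show ?thesis by blast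
qed

theorem theorem5:
  shows "\<exists>(p :: com) (C :: real). C > 0 \<and> polynomial_time p \<and>
    approximation_algorithm (\<lambda>I. C * (1 + log 2 (real_of_rat (demand_ratio I)))) p"
proof -
  have enc: "encode_instance I = enc (machines I, jobs I)" for I
  proof -
    have "(\<lambda>(d, f). Node (encode_rat d) (Num f)) = (enc :: rat \<times> nat \<Rightarrow> val)"
      by (auto simp: enc_prod_def enc_rat_def enc_nat_def)
    then show ?thesis by (simp add: encode_instance_def enc_prod_def enc_list_def enc_rat_def)
  qed
  obtain p k where p: "\<And>I s. s 0 = enc I \<Longrightarrow>
     \<exists>s'. exec_within p s ((size_of I + val_size (s 1) + 2) ^ k) s' \<and> s' 0 = enc (solve I) \<and> s' 1 = s 1"
    using ptime_solve unfolding ptime_def by blast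
  \<comment> \<open>No solution is assumed here: the program stops within the bound on every
    instance, which \<open>polynomial_time\<close> demands.\<close>
  have run: "\<exists>t. run p (encode_instance I) t (enc (solve (machines I, jobs I))) \<and>
      t \<le> (val_size (encode_instance I) + 3) ^ k" for I
  proof -
    let ?s = "(\<lambda>_. Num 0)(0 := encode_instance I) :: state"
    have "\<exists>s'. exec_within p ?s ((val_size (encode_instance I) + val_size (?s 1) + 2) ^ k) s' \<and>
        s' 0 = enc (solve (machines I, jobs I)) \<and> s' 1 = ?s 1"
      unfolding enc by (rule p[of "(\<lambda>_. Num 0)(0 := enc (machines I, jobs I))" "(machines I, jobs I)"]) simp
    moreover have "val_size (encode_instance I) + val_size (?s 1) + 2 = val_size (encode_instance I) + 3"
      by simp
    ultimately show ?thesis unfolding exec_within_def run_def by metis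
  qed
  have "polynomial_time p"
    unfolding polynomial_time_def polynomial_time_on_def
  \<comment> \<open>\<open>[:3, 1:]\<close> is \<open>x + 3\<close>: the initial stack
    \<open>Num 0\<close> has size 1, and 2 comes from the base of the time bound.\<close>
  proof (intro exI[of _ "[:3, 1:] ^ k"] ballI)
    fix x assume "x \<in> encode_instance ` {I. valid_instance I}"
    then obtain I where "x = encode_instance I" by blast
    then show "\<exists>t y. run p x t y \<and> t \<le> poly ([:3, 1:] ^ k) (val_size x)"
      using run[of I] by (auto simp: poly_power add.commute)
  qed
  moreover have "approximation_algorithm (\<lambda>I. 16 * (1 + log 2 (real_of_rat (demand_ratio I)))) p"
    unfolding approximation_algorithm_def outputs_def
    using run solve_correct by metis
  ultimately show ?thesis by (intro exI[of _ p] exI[of _ 16]) simp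
qed

end
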